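(* Let $p$ be a prime, let $n \geq 2$ be an integer, let $q = p^s$ and $r = q^t$ with integers $s, t \geq 1$, and assume \[ r \geq \frac{3n + 2 + \sqrt{9n^2 + 4n + 4}}{2}. \] If $q \geq 4$, then there exist algebraic Laurent series $\alpha \in \mathbb{F}_q((T^{-1}))$ with $\deg \alpha = r+1$ such that $w_n(\alpha) \neq w_n^{*}(\alpha)$.
   Context: $\mathbb{F}_q((T^{-1}))$ is the field of Laurent series $\xi=\sum_{m\ge N} a_m T^{-m}$ ($a_m\in\mathbb{F}_q$) with the absolute value $|\xi| = q^{-N}$ when $a_N \neq 0$, and $|0|=0$; this absolute value is extended uniquely to an algebraic closure of $\mathbb{F}_q((T^{-1}))$. The height $H(P)$ of $P \in (\mathbb{F}_q[T])[X]$ is the maximum of the absolute values of its coefficients. For $\alpha$ algebraic over $\mathbb{F}_q(T)$, its minimal polynomial is the unique non-constant, irreducible, primitive polynomial $P\in(\mathbb{F}_q[T])[X]$ whose leading coefficient is monic in $T$ and with $P(\alpha)=0$; $H(\alpha):=H(P)$ and $\deg\alpha:=\deg P$. For an integer $n\ge1$ and $\xi \in \mathbb{F}_q((T^{-1}))$, $w_n(\xi)$ is the supremum of real $w$ such that $0<|P(\xi)|\le H(P)^{-w}$ for infinitely many $P\in(\mathbb{F}_q[T])[X]$ of degree at most $n$, and $w_n^*(\xi)$ is the supremum of real $w^*$ such that $0<|\xi-\alpha|\le H(\alpha)^{-w^*-1}$ for infinitely many $\alpha\in\overline{\mathbb{F}_q(T)}$ of degree at most $n$. *)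

theory Defs
  imports "HOL-Computational_Algebra.Computational_Algebra" "HOL-Library.Extended_Real"
begin

text \<open>Model: F_q = finite field 'a (q = card (UNIV :: 'a set)); F_q[T] = 'a poly;
  F_q((T^-1)) = 'a fls with formal variable X = T^-1, so T = fls_X_inv.\<close>

definition T_poly_to_fls :: "'a::field poly \<Rightarrow> 'a fls" where
  "T_poly_to_fls P = (\<Sum>i\<le>degree P. fls_const (coeff P i) * fls_X_inv ^ i)"

definition fls_absval :: "'a::{finite,field} fls \<Rightarrow> real" where
  "fls_absval xi = (if xi = 0 then 0 else real (card (UNIV :: 'a set)) powr (- real_of_int (fls_subdegree xi)))"

definition Tpoly_absval :: "'a::{finite,field} poly \<Rightarrow> real" where
  "Tpoly_absval c = (if c = 0 then 0 else real (card (UNIV :: 'a set)) ^ degree c)"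

definition height :: "'a::{finite,field} poly poly \<Rightarrow> real" where
  "height P = Max ((\<lambda>i. Tpoly_absval (coeff P i)) ` {..degree P})"

definition primitive_poly :: "'a::field poly poly \<Rightarrow> bool" where
  "primitive_poly P \<longleftrightarrow> (\<forall>d. (\<forall>i. d dvd coeff P i) \<longrightarrow> is_unit d)"

definition is_minpoly :: "('a::field poly \<Rightarrow> 'c::field) \<Rightarrow> 'c \<Rightarrow> 'a poly poly \<Rightarrow> bool" where
  "is_minpoly e alpha P \<longleftrightarrow> degree P \<ge> 1 \<and> irreducible P \<and> primitive_poly P
      \<and> lead_coeff (lead_coeff P) = 1 \<and> poly (map_poly e P) alpha = 0"

definition is_algebraic_over_FqT :: "('a::field poly \<Rightarrow> 'c::field) \<Rightarrow> 'c \<Rightarrow> bool" where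
  "is_algebraic_over_FqT e alpha \<longleftrightarrow> (\<exists>P. is_minpoly e alpha P)"

definition minpoly :: "('a::field poly \<Rightarrow> 'c::field) \<Rightarrow> 'c \<Rightarrow> 'a poly poly" where
  "minpoly e alpha = (THE P. is_minpoly e alpha P)"

definition alg_deg :: "('a::field poly \<Rightarrow> 'c::field) \<Rightarrow> 'c \<Rightarrow> nat" where
  "alg_deg e alpha = degree (minpoly e alpha)"

definition alg_height :: "('a::{finite,field} poly \<Rightarrow> 'c::field) \<Rightarrow> 'c \<Rightarrow> real" where
  "alg_height e alpha = height (minpoly e alpha)"

definition w_exp :: "nat \<Rightarrow> 'a::{finite,field} fls \<Rightarrow> ereal" where
  "w_exp n xi = Sup {ereal w | w. infinite {P :: 'a poly poly. degree P \<le> n \<and>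
      0 < fls_absval (poly (map_poly T_poly_to_fls P) xi) \<and>
      fls_absval (poly (map_poly T_poly_to_fls P) xi) \<le> height P powr (- w)}}"

text \<open>A model of the algebraic closure of F_q((T^-1)) with the (unique) extension v of the
  absolute value: iota embeds F_q((T^-1)) into the algebraically closed field 'b,
  which is algebraic over the image, and v is an absolute value on 'b extending |.|.\<close>
definition alg_closure_model :: "('a::{finite,field} fls \<Rightarrow> 'b::field) \<Rightarrow> ('b \<Rightarrow> real) \<Rightarrow> bool" where
  "alg_closure_model iota v \<longleftrightarrow>
     (\<forall>x y. iota (x + y) = iota x + iota y) \<and> (\<forall>x y. iota (x * y) = iota x * iota y) \<and> iota 1 = 1
   \<and> (\<forall>p :: 'b poly. degree p \<ge> 1 \<longrightarrow> (\<exists>z. poly p z = 0))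
   \<and> (\<forall>z. \<exists>p :: 'a fls poly. p \<noteq> 0 \<and> poly (map_poly iota p) z = 0)
   \<and> (\<forall>z. v z \<ge> 0) \<and> (\<forall>z. v z = 0 \<longleftrightarrow> z = 0)
   \<and> (\<forall>y z. v (y * z) = v y * v z) \<and> (\<forall>y z. v (y + z) \<le> v y + v z)
   \<and> (\<forall>x. v (iota x) = fls_absval x)"

definition wstar_exp :: "('a::{finite,field} fls \<Rightarrow> 'b::field) \<Rightarrow> ('b \<Rightarrow> real) \<Rightarrow> nat \<Rightarrow> 'a fls \<Rightarrow> ereal" where
  "wstar_exp iota v n xi = Sup {ereal w | w. infinite {alpha :: 'b.
      is_algebraic_over_FqT (iota \<circ> T_poly_to_fls) alpha \<and>
      alg_deg (iota \<circ> T_poly_to_fls) alpha \<le> n \<and>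
      0 < v (iota xi - alpha) \<and>
      v (iota xi - alpha) \<le> alg_height (iota \<circ> T_poly_to_fls) alpha powr (- w - 1)}}"

end

theory Submission
  imports Defs
begin

text \<open>
  Let W be the matrix of y \<mapsto> 1 / (T + y) and N = W^L, where L = 2 r^2. Then N is unimodular and
  fixes the quadratic form P = X^2 + T X - 1. Let alpha be the fixed point of x \<mapsto> N(x^r) with
  |alpha| < 1; its continued fraction consists of L copies of T, then L copies of T^r, and so on.
  Raising coefficients to the power r and substituting the inverse of N turns P into forms P_j,
  which stay primitive and irreducible. They satisfy |P_j(alpha)| \<le> H(P_j)^(-w) with w close to r,
  but the discriminant of P_j is small, so the two roots of P_j are close to each other and each
  of them is only about H(P_j)^(-r) away from alpha. Hence w_n(alpha) \<ge> r - 1/4.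

  For any Q coprime to P_j the resultant of P_j and Q is a nonzero element of F_q[T]. Choosing j
  according to H(Q), this bounds |Q(alpha)| from below. The hypothesis on r makes this bound strong
  enough that no algebraic number of degree at most n other than the roots of the P_j is closer to
  alpha than these roots, which gives w_n^*(alpha) \<le> r - 1/2. The same resultant shows that
  alpha is not a root of any polynomial of degree at most r.
\<close>

section \<open>Minimal polynomials over \<open>F_q[T]\<close>\<close>

text \<open>Only the gap between r - 1/4 and r - 1/2 matters, so neither exponent is computed. Along
  the recursion the ratio of -log |P_j(alpha)| to log H(P_j) tends to 2 L r^2 / (2 L r + (r - 1)^2),
  which falls short of r by less than (r - 1)^2 / (2 L). Thus L = 2 r^2 keeps the loss below 1/4,
  and since L is even, W^L has determinant 1 although W has determinant -1. On the other side, the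
  square of P_j'(alpha) is the discriminant of P_j up to a small error. The discriminant is a power
  of T^2 + 4 to which N contributes nothing, so the bound H(P_j) for it is generous; it keeps the
  roots at distance at least about H(P_j)^(-r - 1/2), which corresponds to w^* + 1 \<le> r + 1/2. A
  competitor of height H is tested against a P_j of height at most about H^(2 r / sigma), with sigma
  = r - n + 3/4, because passing to the next form roughly raises the height to the power r. The
  resultant then keeps the competitor at distance H^(-2 r n / sigma - 2), and the hypothesis on r
  makes this no smaller than H^(-r - 1/2).\<close>

locale T_embedding =
  fixes e :: "'a::field poly \<Rightarrow> 'c::field"
  assumes e_add: "e (a + b) = e a + e b"
    and e_mult: "e (a * b) = e a * e b"
    and e_1: "e 1 = 1"
    and e_inj: "e a = 0 \<Longrightarrow> a = 0"
begin

abbreviation ev :: "'a poly poly \<Rightarrow> 'c \<Rightarrow> 'c" where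
  "ev P x \<equiv> poly (map_poly e P) x"

lemma e_0 [simp]: "e 0 = 0"
  using e_add[of 0 0] by (metis add_0 add_cancel_right_left)

lemma e_0_iff [simp]: "e a = 0 \<longleftrightarrow> a = 0"
  using e_inj e_0 by blast

lemma e_minus: "e (- a) = - e a"
  using e_add[of a "- a"] by (simp add: minus_unique)

lemma e_diff: "e (a - b) = e a - e b"
  using e_add[of a "- b"] by (simp add: e_minus)

lemma e_power: "e (a ^ k) = e a ^ k"
  by (induction k) (simp_all add: e_1 e_mult)

lemma ev_pCons: "ev (pCons a P) x = e a + x * ev P x"
  by (simp add: map_poly_pCons)

lemma ev_add: "ev (P + Q) x = ev P x + ev Q x"
  by (induction P Q rule: poly_induct2) (simp_all add: ev_pCons e_add algebra_simps)

lemma ev_smult: "ev (smult a P) x = e a * ev P x"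
  by (induction P) (simp_all add: ev_pCons e_mult algebra_simps)

lemma ev_mult: "ev (P * Q) x = ev P x * ev Q x"
  by (induction P) (simp_all add: ev_add ev_smult ev_pCons algebra_simps)

lemma ev_altdef: "ev P x = (\<Sum>i\<le>degree P. e (coeff P i) * x ^ i)"
  unfolding poly_altdef
  by (simp add: coeff_map_poly degree_map_poly)

lemma map_poly_e_0_iff: "map_poly e P = 0 \<longleftrightarrow> P = 0"
  by (simp add: map_poly_eq_0_iff)

end

lemma smult_cancel_left:
  fixes P Q :: "'a::idom poly"
  assumes "smult c P = smult c Q" "c \<noteq> 0"
  shows "P = Q"
proof -
  have "smult c (P - Q) = 0" using assms by (simp add: smult_diff_right)
  thus ?thesis using assms by simp
qed

text \<open>Stands in for Gauss's lemma: the type \<open>'a poly\<close> over an arbitrary field \<open>'a\<close> is no instance of the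
  gcd classes under which the library proves it.\<close>

lemma smult_eq_mult_imp:
  fixes P Q S :: "'a::field poly poly"
  assumes "c \<noteq> 0" "smult c P = Q * S"
  shows "\<exists>Q' S' d d'. P = Q' * S' \<and> Q = smult d Q' \<and> S = smult d' S'"
  using assms
proof (induction "degree c" arbitrary: c Q S rule: less_induct)
  case less
  show ?case
  proof (cases "is_unit c")
    case True
    then obtain c' where c': "c' * c = 1" by (metis dvd_def mult.commute)
    have "P = smult c' (smult c P)" using c' by simp
    hence "P = smult c' Q * S" using less.prems by simp
    moreover have "Q = smult c (smult c' Q)" using c' by (simp add: mult.commute)
    moreover have "S = smult 1 S" by simp
    ultimately show ?thesis by blast
  next
    case False
    have "\<exists>p. irreducible p \<and> p dvd c" 
      using False less.prems(1)
    proof (induction "degree c" arbitrary: c rule: less_induct)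
      case less
      show ?case
      proof (cases "irreducible c")
        case False
        then obtain a b where ab: "c = a * b" "\<not> is_unit a" "\<not> is_unit b"
          using less.prems unfolding irreducible_def by blast
        have nz: "a \<noteq> 0" "b \<noteq> 0" using ab less.prems by auto
        have "degree b > 0" using ab(3) nz is_unit_iff_degree[of b] by auto
        hence "degree a < degree c" using ab nz by (simp add: degree_mult_eq)
        from less.hyps[OF this ab(2) nz(1)] ab(1) show ?thesis by (auto intro: dvd_mult2)
      qed auto
    qed
    then obtain p where p: "irreducible p" "p dvd c" by blast
    then obtain c1 where c1: "c = p * c1" by (elim dvdE)
    have p0: "p \<noteq> 0" "c1 \<noteq> 0" using c1 less.prems by auto
    have "degree p > 0" using p(1) p0 is_unit_iff_degree[of p] by (auto simp: irreducible_def)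
    hence deg: "degree c1 < degree c" using p0 c1 by (simp add: degree_mult_eq)
    \<comment> \<open>The core of Gauss's lemma: a prime of the coefficient ring stays prime as a
      constant polynomial, so it divides \<open>Q\<close> or \<open>S\<close> and can be cancelled
      there.\<close>
    have "prime_elem [:p:]"
      using p(1) by (simp add: prime_elem_const_poly_iff field_poly_irreducible_imp_prime)
    moreover have "[:p:] dvd Q * S"
    proof -
      have "Q * S = [:p:] * smult c1 P" using less.prems(2) c1 by (simp add: mult.commute)
      thus ?thesis by (rule dvdI)
    qed
    ultimately consider "[:p:] dvd Q" | "[:p:] dvd S" by (auto simp: prime_elem_dvd_mult_iff)
    thus ?thesis
    proof cases
      case 1
      then obtain Q1 where Q1: "Q = [:p:] * Q1" by (elim dvdE)
      have "smult p (smult c1 P) = smult p (Q1 * S)" using less.prems(2) c1 Q1 by simp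
      hence "smult c1 P = Q1 * S" using p0(1) by (rule smult_cancel_left)
      then obtain Q' S' d d' where "P = Q' * S'" "Q1 = smult d Q'" "S = smult d' S'"
        using less.hyps[OF deg p0(2)] by blast
      hence "P = Q' * S' \<and> Q = smult (p * d) Q' \<and> S = smult d' S'"
        using Q1 by (simp add: mult.commute)
      thus ?thesis by blast
    next
      case 2
      then obtain Q1 where Q1: "S = [:p:] * Q1" by (elim dvdE)
      have "smult p (smult c1 P) = smult p (Q * Q1)" using less.prems(2) c1 Q1 by simp
      hence "smult c1 P = Q * Q1" using p0(1) by (rule smult_cancel_left)
      then obtain Q' S' d d' where "P = Q' * S'" "Q = smult d Q'" "Q1 = smult d' S'"
        using less.hyps[OF deg p0(2)] by blast
      hence "P = Q' * S' \<and> Q = smult d Q' \<and> S = smult (p * d') S'"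
        using Q1 by (simp add: mult.commute)
      thus ?thesis by blast
    qed
  qed
qed

lemma primitive_smult_unit:
  "primitive_poly (smult d P) \<Longrightarrow> is_unit d"
  by (simp add: primitive_poly_def)

text \<open>\<open>Z\<close> stands for membership in an ideal, here the polynomials vanishing at a
  point. The pseudo-remainder lies in the ideal and has smaller degree than \<open>P\<close>, so it
  is 0; the factor \<open>c\<close> is the price of dividing over a ring.\<close>

lemma degree_minimal_dvd_smult:
  fixes P Q :: "'a::field poly poly"
  assumes I: "\<And>A B. Z A \<Longrightarrow> Z (A * B)" "\<And>A B. Z A \<Longrightarrow> Z B \<Longrightarrow> Z (A - B)"
    and P: "Z P" "P \<noteq> 0" "\<And>R. Z R \<Longrightarrow> R \<noteq> 0 \<Longrightarrow> degree P \<le> degree R" and Q: "Z Q"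
  shows "\<exists>c S. c \<noteq> 0 \<and> smult c Q = P * S"
proof -
  obtain S R where SR: "pseudo_divmod Q P = (S, R)" by fastforce
  note * = pseudo_divmod[OF P(2) SR]
  let ?c = "coeff P (degree P) ^ (Suc (degree Q) - degree P)"
  have "R = Q * [:?c:] - P * S" using *(1) by (simp add: algebra_simps)
  hence "Z R" using I P(1) Q by blast
  hence "R = 0" using *(2) P(3) by force
  thus ?thesis using *(1) P(2) by (intro exI[of _ ?c] exI[of _ S]) auto
qed

context T_embedding
begin

text \<open>A vanishing polynomial \<open>Q\<close> of least degree divides a multiple of
  \<open>P\<close>. Moving the scalar into the factors gives a genuine factorisation of
  \<open>P\<close>, and irreducibility makes the cofactor a unit.\<close>

lemma minimal_degree_of_minpoly:
  assumes P: "is_minpoly e x P" and R: "R \<noteq> 0" "ev R x = 0"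
  shows "degree P \<le> degree R"
proof -
  define d where "d = (LEAST d. \<exists>R. R \<noteq> 0 \<and> ev R x = 0 \<and> degree R = d)"
  have "\<exists>Q. Q \<noteq> 0 \<and> ev Q x = 0 \<and> degree Q = d"
    unfolding d_def by (rule LeastI_ex) (use R in blast)
  then obtain Q where Q: "Q \<noteq> 0" "ev Q x = 0" "degree Q = d" by blast
  have min: "d \<le> degree S" if "S \<noteq> 0" "ev S x = 0" for S
    unfolding d_def by (rule Least_le) (use that in blast)
  have ev_diff: "ev (A - B) x = 0" if "ev A x = 0" "ev B x = 0" for A B
    using ev_add[of "A - B" B x] that by simp
  have P': "P \<noteq> 0" "ev P x = 0" "irreducible P" using P by (auto simp: is_minpoly_def irreducible_def)
  obtain c S where cS: "c \<noteq> 0" "smult c P = Q * S"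
    using degree_minimal_dvd_smult[of "\<lambda>A. ev A x = 0" Q P] min Q P' ev_diff
    by (auto simp: ev_mult)
  obtain Q' S' u u' where *: "P = Q' * S'" "Q = smult u Q'" "S = smult u' S'"
    using smult_eq_mult_imp[OF cS] by blast
  have u: "u \<noteq> 0" using * Q by auto
  have degQ: "degree Q' = d" using * Q u by auto
  have "d \<noteq> 0"
  proof
    assume "d = 0"
    hence "degree Q = 0" using Q by simp
    then obtain a where "Q = [:a:]" by (elim degree_eq_zeroE)
    thus False using Q by (simp add: ev_pCons)
  qed
  hence "\<not> is_unit Q'" using degQ by (auto elim!: is_unit_polyE)
  hence "is_unit S'" using P'(3) * unfolding irreducible_def by blast
  hence "degree S' = 0" by (auto elim: is_unit_polyE)
  hence "degree P = d" using * degQ P' by (simp add: degree_mult_eq)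
  thus ?thesis using min R by simp
qed

text \<open>Pseudo-division gives divisibility up to scalars; the scalar \<open>u\<close> split off
  from \<open>P\<close> divides all its coefficients, so it is a unit by primitivity.\<close>

lemma minpoly_dvd:
  assumes P: "is_minpoly e x P" and Q: "ev Q x = 0"
  shows "P dvd Q"
proof -
  have ev_diff: "ev (A - B) x = 0" if "ev A x = 0" "ev B x = 0" for A B
    using ev_add[of "A - B" B x] that by simp
  have P': "P \<noteq> 0" "ev P x = 0" "irreducible P" "primitive_poly P"
    using P by (auto simp: is_minpoly_def irreducible_def)
  obtain c S where cS: "c \<noteq> 0" "smult c Q = P * S"
    using degree_minimal_dvd_smult[of "\<lambda>A. ev A x = 0" P Q] minimal_degree_of_minpoly[OF P] Q P' ev_diff
    by (auto simp: ev_mult)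
  obtain P1 S' u u' where *: "Q = P1 * S'" "P = smult u P1" "S = smult u' S'"
    using smult_eq_mult_imp[OF cS] by blast
  have "is_unit u" using *(2) P'(4) primitive_smult_unit by blast
  then obtain u1 where "1 = u * u1" by (elim dvdE)
  hence "P1 = smult u1 P" using *(2) by (simp add: mult.commute)
  hence "P1 = P * [:u1:]" by simp
  hence "P dvd P1" by (rule dvdI)
  thus ?thesis using *(1) by simp
qed

lemma minpoly_unique:
  assumes P: "is_minpoly e x P" and Q: "is_minpoly e x Q"
  shows "P = Q"
proof -
  have nz: "P \<noteq> 0" "Q \<noteq> 0" using P Q by (auto simp: is_minpoly_def irreducible_def)
  have "P dvd Q" "Q dvd P" using minpoly_dvd[of x] P Q by (auto simp: is_minpoly_def)
  then obtain S S2 where S2: "Q = P * S" "P = Q * S2" unfolding dvd_def by blast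
  hence "P * 1 = P * (S * S2)" by (metis mult.assoc mult.right_neutral)
  hence "1 = S * S2" using nz mult_left_cancel[of P] by blast
  hence S: "Q = P * S" "is_unit S" using S2 by (simp, intro dvdI)
  then obtain s where s: "S = [:s:]" "is_unit s" by (auto elim: is_unit_polyE)
  then obtain t where t: "s = [:t:]" by (auto elim: is_unit_polyE)
  have "lead_coeff (lead_coeff Q) = lead_coeff (lead_coeff P) * t"
    using S(1) s(1) t by (simp add: lead_coeff_mult)
  hence "t = 1" using P Q by (simp add: is_minpoly_def)
  thus ?thesis using S(1) s t by (simp add: one_pCons[symmetric])
qed

lemma minpoly_eqI: "is_minpoly e x P \<Longrightarrow> minpoly e x = P"
  unfolding minpoly_def using minpoly_unique by blast

text \<open>Minimising the degree first and the degree of the leading coefficient second gives both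
  properties at once: a proper factor would lower the first component, a non-unit constant factor
  the second.\<close>

lemma minpoly_exists:
  assumes F: "F \<noteq> 0" "ev F x = 0"
  shows "\<exists>P. is_minpoly e x P"
proof -
  define m where "m = (\<lambda>R :: 'a poly poly. (degree R, degree (lead_coeff R)))"
  obtain P where P: "P \<noteq> 0" "ev P x = 0"
    and min: "\<And>R. (m R, m P) \<in> less_than <*lex*> less_than \<Longrightarrow> \<not> (R \<noteq> 0 \<and> ev R x = 0)"
    using wfE_min[of "inv_image (less_than <*lex*> less_than) m" F "{R. R \<noteq> 0 \<and> ev R x = 0}"] F
    by (auto simp: wf_inv_image wf_lex_prod)
  have mindeg: "degree P \<le> degree R" if "R \<noteq> 0" "ev R x = 0" for R
    using min[of R] that by (force simp: m_def)
  have deg: "degree P \<ge> 1"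
  proof (rule ccontr)
    assume "\<not> ?thesis"
    hence "degree P = 0" by simp
    then obtain a where "P = [:a:]" by (elim degree_eq_zeroE)
    thus False using P by (simp add: ev_pCons)
  qed
  have prim: "is_unit d" if "P = smult d R" for d R
  proof (rule ccontr)
    assume "\<not> is_unit d"
    moreover have d: "d \<noteq> 0" "R \<noteq> 0" using that P by auto
    ultimately have "degree d > 0" using is_unit_iff_degree[of d] by auto
    hence "(m R, m P) \<in> less_than <*lex*> less_than"
      using d that by (auto simp: m_def degree_mult_eq)
    moreover have "ev R x = 0" using P that d by (simp add: ev_smult)
    ultimately show False using min d by blast
  qed
  have irr: "irreducible P"
  proof (rule irreducibleI)
    show "P \<noteq> 0" by fact
    show "\<not> is_unit P" using deg by (auto elim!: is_unit_polyE)
    have *: "is_unit B" if "P = A * B" "ev A x = 0" for A B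
    proof -
      have nz: "A \<noteq> 0" "B \<noteq> 0" using that P by auto
      have "degree B = 0" using mindeg[of A] that nz by (simp add: degree_mult_eq)
      then obtain b where b: "B = [:b:]" by (elim degree_eq_zeroE)
      thus ?thesis using prim[of b A] that by (simp add: is_unit_const_poly_iff)
    qed
    fix A B assume AB: "P = A * B"
    hence "ev A x = 0 \<or> ev B x = 0" using P by (simp add: ev_mult)
    thus "is_unit A \<or> is_unit B" using *[of A B] *[of B A] AB by (auto simp: mult.commute)
  qed
  define l where "l = lead_coeff (lead_coeff P)"
  have l: "l \<noteq> 0" using P by (simp add: l_def)
  define P' where "P' = smult [:inverse l:] P"
  have PP': "P = smult [:l:] P'" using l by (simp add: P'_def one_pCons[symmetric])
  have "is_minpoly e x P'"
    unfolding is_minpoly_def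
  proof (intro conjI)
    show "degree P' \<ge> 1" using deg l by (simp add: P'_def)
    show "irreducible P'"
    proof (rule irreducibleI)
      show "P' \<noteq> 0" using PP' P by auto
      have "degree P' \<ge> 1" using deg l by (simp add: P'_def)
      thus "\<not> is_unit P'" by (auto elim!: is_unit_polyE)
      fix A B assume "P' = A * B"
      hence "P = smult [:l:] A * B" using PP' by simp
      hence "is_unit (smult [:l:] A) \<or> is_unit B" using irr by (blast dest: irreducibleD)
      moreover have "A dvd smult [:l:] A" by (rule dvd_smult) simp
      ultimately show "is_unit A \<or> is_unit B" using dvd_trans by blast
    qed
    show "primitive_poly P'" unfolding primitive_poly_def
    proof (intro allI impI)
      fix d assume "\<forall>i. d dvd coeff P' i"
      hence "[:d:] dvd P'" by (simp add: const_poly_dvd_iff)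
      then obtain R where "P' = [:d:] * R" by (elim dvdE)
      hence "P = smult d (smult [:l:] R)" using PP' by (simp add: mult.commute)
      thus "is_unit d" by (rule prim)
    qed
    show "lead_coeff (lead_coeff P') = 1" using l by (simp add: P'_def l_def)
    show "ev P' x = 0" using P by (simp add: P'_def ev_smult)
  qed
  thus ?thesis by blast
qed

end

section \<open>The absolute value on Laurent series\<close>

lemma card_field_gt_1: "real (card (UNIV :: 'a::{finite,field} set)) > 1"
proof -
  have "card {0, 1 :: 'a} \<le> card (UNIV :: 'a set)" by (intro card_mono) auto
  thus ?thesis by simp
qed

abbreviation base :: "'a::{finite,field} itself \<Rightarrow> real" where
  "base _ \<equiv> real (card (UNIV :: 'a set))"

lemma abv_0 [simp]: "fls_absval 0 = 0"
  by (simp add: fls_absval_def)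

lemma abv_1 [simp]: "fls_absval (1 :: 'a::{finite,field} fls) = 1"
  using card_field_gt_1[where 'a='a] by (simp add: fls_absval_def)

lemma abv_nonneg [simp]: "fls_absval x \<ge> 0"
  by (simp add: fls_absval_def)

lemma abv_pos: "x \<noteq> 0 \<Longrightarrow> fls_absval (x :: 'a::{finite,field} fls) > 0"
  using card_field_gt_1[where 'a='a] by (simp add: fls_absval_def)

lemma abv_eq_0_iff [simp]: "fls_absval x = 0 \<longleftrightarrow> x = 0"
  using abv_pos[of x] by force

lemma abv_mult: "fls_absval (x * y) = fls_absval x * fls_absval y"
  by (simp add: fls_absval_def powr_add[symmetric] algebra_simps)

lemma abv_power: "fls_absval (x ^ k) = fls_absval x ^ k"
  by (induction k) (simp_all add: abv_mult)

lemma abv_inverse: "fls_absval (inverse x) = inverse (fls_absval x)"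
proof (cases "x = 0")
  case False
  hence "fls_absval x * fls_absval (inverse x) = 1"
    by (simp flip: abv_mult)
  thus ?thesis by (simp add: inverse_unique)
qed simp

lemma abv_divide: "fls_absval (x / y) = fls_absval x / fls_absval y"
  by (simp add: divide_inverse abv_mult abv_inverse)

lemma abv_uminus [simp]: "fls_absval (- x) = fls_absval x"
  by (simp add: fls_absval_def)

lemma abv_less_iff:
  fixes z :: "'a::{finite,field} fls"
  shows "fls_absval z < base TYPE('a) powr (- real_of_int k) \<longleftrightarrow> (\<forall>i\<le>k. fls_nth z i = 0)"
proof (cases "z = 0")
  case True
  thus ?thesis using card_field_gt_1[where 'a='a] by simp
next
  case False
  have "fls_absval z < base TYPE('a) powr (- real_of_int k) \<longleftrightarrow> k < fls_subdegree z"
    using False card_field_gt_1[where 'a='a] by (simp add: fls_absval_def)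
  also have "\<dots> \<longleftrightarrow> (\<forall>i\<le>k. fls_nth z i = 0)"
    using False nth_fls_subdegree_nonzero[OF False] fls_subdegree_geI[OF False, of "k+1"]
    by (metis add1_zle_eq dual_order.strict_trans2 fls_eq0_below_subdegree linorder_not_le zless_add1_eq zle_add1_eq_le)
  finally show ?thesis .
qed

lemma abv_add_le: "fls_absval (x + y) \<le> max (fls_absval x) (fls_absval (y :: 'a::{finite,field} fls))"
proof (cases "x = 0 \<or> y = 0 \<or> x + y = 0")
  case False
  hence "fls_subdegree (x + y) \<ge> min (fls_subdegree x) (fls_subdegree y)"
    by (intro fls_plus_subdegree) auto
  thus ?thesis using False card_field_gt_1[where 'a='a]
    by (auto simp: fls_absval_def max_def min_def split: if_splits)
qed (auto simp: le_max_iff_disj)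

lemma abv_diff_le: "fls_absval (x - y) \<le> max (fls_absval x) (fls_absval (y :: 'a::{finite,field} fls))"
  using abv_add_le[of x "- y"] by simp

lemma abv_add_eq:
  assumes "fls_absval y < fls_absval (x :: 'a::{finite,field} fls)"
  shows "fls_absval (x + y) = fls_absval x"
proof (rule antisym)
  show "fls_absval (x + y) \<le> fls_absval x" using abv_add_le[of x y] assms by simp
  have "fls_absval x \<le> max (fls_absval (x + y)) (fls_absval y)"
    using abv_diff_le[of "x + y" y] by simp
  thus "fls_absval x \<le> fls_absval (x + y)" using assms by (simp add: max_def split: if_splits)
qed

lemma abv_diff_eq:
  "fls_absval y < fls_absval x \<Longrightarrow> fls_absval (x - y :: 'a::{finite,field} fls) = fls_absval x"
  using abv_add_eq[of "- y" x] by simp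

lemma T_poly_to_fls_altdef: "T_poly_to_fls P = poly (map_poly fls_const P) fls_X_inv"
  by (simp add: T_poly_to_fls_def poly_altdef coeff_map_poly degree_map_poly)

lemma T_poly_to_fls_pCons:
  "T_poly_to_fls (pCons a P) = fls_const a + fls_X_inv * T_poly_to_fls P"
  by (simp add: T_poly_to_fls_altdef map_poly_pCons)

lemma T_poly_to_fls_0 [simp]: "T_poly_to_fls 0 = 0"
  by (simp add: T_poly_to_fls_altdef)

lemma T_poly_to_fls_add: "T_poly_to_fls (P + Q) = T_poly_to_fls P + T_poly_to_fls Q"
  by (induction P Q rule: poly_induct2)
     (simp_all add: T_poly_to_fls_pCons algebra_simps flip: fls_plus_const)

lemma T_poly_to_fls_smult: "T_poly_to_fls (smult a P) = fls_const a * T_poly_to_fls P"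
  by (induction P) (simp_all add: T_poly_to_fls_pCons algebra_simps flip: fls_const_mult_const)

lemma T_poly_to_fls_mult: "T_poly_to_fls (P * Q) = T_poly_to_fls P * T_poly_to_fls Q"
  by (induction P)
     (simp_all add: T_poly_to_fls_pCons T_poly_to_fls_add T_poly_to_fls_smult algebra_simps)

lemma abv_T_poly_to_fls:
  fixes P :: "'a::{finite,field} poly"
  shows "fls_absval (T_poly_to_fls P) = Tpoly_absval P"
proof -
  have X: "fls_absval (fls_X_inv :: 'a fls) = base TYPE('a)"
    by (simp add: fls_absval_def)
  have c: "fls_absval (fls_const a :: 'a fls) = (if a = 0 then 0 else 1)" for a
    using card_field_gt_1[where 'a='a] by (simp add: fls_absval_def)
  show ?thesis
  proof (induction P)
    case (pCons a P)
    show ?case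
    proof (cases "P = 0")
      case False
      have "1 < base TYPE('a) * base TYPE('a) ^ degree P"
        using card_field_gt_1[where 'a='a] by (metis one_less_power power_Suc zero_less_Suc)
      thus ?thesis using False pCons.IH
        by (subst T_poly_to_fls_pCons, subst add.commute, subst abv_add_eq)
           (auto simp: abv_mult X c Tpoly_absval_def)
    qed (auto simp: T_poly_to_fls_pCons c Tpoly_absval_def)
  qed (simp add: Tpoly_absval_def)
qed

interpretation T: T_embedding "T_poly_to_fls :: 'a::{finite,field} poly \<Rightarrow> 'a fls"
proof
  fix a :: "'a poly" assume "T_poly_to_fls a = 0"
  hence "Tpoly_absval a = 0" using abv_T_poly_to_fls[of a] by simp
  thus "a = 0" using card_field_gt_1[where 'a='a] by (auto simp: Tpoly_absval_def split: if_splits)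
qed (simp_all add: T_poly_to_fls_add T_poly_to_fls_mult one_pCons T_poly_to_fls_pCons)

lemma Tpoly_absval_ge_1: "P \<noteq> 0 \<Longrightarrow> Tpoly_absval (P :: 'a::{finite,field} poly) \<ge> 1"
  using card_field_gt_1[where 'a='a] by (simp add: Tpoly_absval_def)

lemma Tpoly_absval_nonneg [simp]: "Tpoly_absval P \<ge> 0"
  by (simp add: Tpoly_absval_def)

lemma Tpoly_absval_le:
  fixes P :: "'a::{finite,field} poly"
  shows "degree P \<le> k \<Longrightarrow> Tpoly_absval P \<le> base TYPE('a) ^ k"
  using card_field_gt_1[where 'a='a] by (simp add: Tpoly_absval_def)

text \<open>Banach's theorem on the open unit ball, with completeness made explicit: each iteration
  fixes one more digit, so the limit can be written down digit by digit.\<close>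

lemma fls_contraction_fixpoint:
  fixes G :: "'a::{finite,field} fls \<Rightarrow> 'a fls"
  assumes ball: "\<And>x. fls_absval x < 1 \<Longrightarrow> fls_absval (G x) < 1"
    and contr: "\<And>x y. fls_absval x < 1 \<Longrightarrow> fls_absval y < 1 \<Longrightarrow>
      fls_absval (G x - G y) \<le> fls_absval (x - y) / base TYPE('a)"
  shows "\<exists>x. fls_absval x < 1 \<and> G x = x"
proof -
  define b where "b = base TYPE('a)"
  have b: "b > 1" using card_field_gt_1[where 'a='a] by (simp add: b_def)
  define s where "s k = (G ^^ k) 0" for k
  have s_Suc: "s (Suc k) = G (s k)" for k by (simp add: s_def)
  have s1: "fls_absval (s k) < 1" for k
    by (induction k) (simp_all add: s_Suc ball, simp add: s_def)
  have powr_Suc: "b powr (- real_of_int (int (Suc k))) = b powr (- real_of_int (int k)) / b" for k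
    using b by (simp add: powr_diff powr_minus_divide powr_add field_simps)
  have step: "fls_absval (s (Suc k) - s k) < b powr (- real_of_int (int k))" for k
  proof (induction k)
    case 0
    show ?case using s1[of 1] b by (simp add: s_def)
  next
    case (Suc k)
    have "fls_absval (s (Suc (Suc k)) - s (Suc k)) \<le> fls_absval (s (Suc k) - s k) / b"
      using contr[OF s1 s1, of "Suc k" k] by (simp add: s_Suc b_def)
    also have "\<dots> < b powr (- real_of_int (int k)) / b"
      using Suc b by (intro divide_strict_right_mono) auto
    finally show ?case by (simp only: powr_Suc)
  qed
  have eq: "fls_nth (s (k + m)) i = fls_nth (s k) i" if "i \<le> int k" for k m i
  proof (induction m)
    case (Suc m)
    have "\<forall>i\<le>int (k+m). fls_nth (s (Suc (k+m)) - s (k+m)) i = 0"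
      using step[of "k + m"] abv_less_iff[of "s (Suc (k+m)) - s (k+m)" "int (k+m)"]
      by (simp add: b_def)
    hence "fls_nth (s (Suc (k+m)) - s (k+m)) i = 0" using that by auto
    thus ?case using Suc by simp
  qed simp
  have s_neg: "fls_nth (s k) i = 0" if "i \<le> 0" for k i
    using s1[of k] abv_less_iff[of "s k" 0] that card_field_gt_1[where 'a='a] by simp
  \<comment> \<open>Digit i is taken from iterate number i, where it is already final. Digits at
    indices up to 0 vanish because all iterates lie in the open unit ball.\<close>
  define x where "x = Abs_fls (\<lambda>i. if i \<le> 0 then 0 else fls_nth (s (nat i)) i)"
  have x_nth: "fls_nth x i = (if i \<le> 0 then 0 else fls_nth (s (nat i)) i)" for i
    unfolding x_def by (rule nth_Abs_fls_lower_bound[of 0]) auto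
  have x_s: "fls_nth (x - s k) i = 0" if "i \<le> int k" for k i
    using eq[of i "nat i" "k - nat i"] that s_neg[of i k] by (auto simp: x_nth)
  have x1: "fls_absval x < 1"
    using abv_less_iff[of x 0] card_field_gt_1[where 'a='a] by (simp add: x_nth)
  have "fls_nth (G x - x) i = 0" for i
  proof -
    define k where "k = nat i"
    have "fls_absval (x - s k) < b powr (- real_of_int (int k))"
      unfolding b_def abv_less_iff using x_s by blast
    hence "fls_absval (x - s k) / b < b powr (- real_of_int (int k))"
      using b by (smt (verit) divide_le_eq mult_less_cancel_left1 abv_nonneg mult_left_le divide_less_eq mult_le_cancel_left1)
    hence "fls_absval (G x - s (Suc k)) < b powr (- real_of_int (int k))"
      using contr[OF x1 s1, of k] by (simp add: s_Suc b_def)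
    hence "fls_nth (G x - s (Suc k)) i = 0"
      unfolding b_def abv_less_iff by (simp add: k_def)
    moreover have "fls_nth (x - s (Suc k)) i = 0" by (rule x_s) (simp add: k_def)
    ultimately show ?thesis by simp
  qed
  hence "G x = x" by (intro fls_eqI) simp
  thus ?thesis using x1 by blast
qed

section \<open>The fixed point\<close>

text \<open>The entries of the powers of the matrix of y \<mapsto> 1 / (T + y).\<close>

fun fib_poly :: "nat \<Rightarrow> 'a::field poly" where
  "fib_poly 0 = 0"
| "fib_poly (Suc 0) = 1"
| "fib_poly (Suc (Suc k)) = [:0, 1:] * fib_poly (Suc k) + fib_poly k"

lemma degree_fib_poly_aux:
  "degree (fib_poly (Suc k) :: 'a::field poly) = k \<and> fib_poly (Suc k) \<noteq> (0 :: 'a poly)"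
proof (induction k rule: less_induct)
  case (less k)
  show ?case
  proof (cases k)
    case (Suc j)
    have j: "degree (fib_poly (Suc j) :: 'a poly) = j" "fib_poly (Suc j) \<noteq> (0 :: 'a poly)"
      using less Suc by auto
    have "degree (fib_poly j :: 'a poly) < Suc j"
      using less[of "j - 1"] Suc by (cases j) auto
    hence "degree (fib_poly (Suc k) :: 'a poly) = k"
      using j Suc by (simp add: degree_add_eq_left)
    thus ?thesis using Suc by (metis degree_0 nat.distinct(1))
  qed simp
qed

lemma degree_fib_poly: "degree (fib_poly (Suc k) :: 'a::field poly) = k"
  using degree_fib_poly_aux by blast

text \<open>This is the determinant of the power \<open>Suc k\<close> of the matrix with rows (0, 1)
  and (1, T), which itself has determinant -1.\<close>

lemma fib_poly_cassini:
  "fib_poly (Suc (Suc k)) * fib_poly k - (fib_poly (Suc k))\<^sup>2 = (-1 :: 'a::field poly) ^ Suc k"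
proof (induction k)
  case (Suc k)
  let ?a = "fib_poly k :: 'a poly" and ?b = "fib_poly (Suc k) :: 'a poly"
  have *: "fib_poly (Suc (Suc k)) = [:0, 1:] * ?b + ?a" 
    "fib_poly (Suc (Suc (Suc k))) = [:0, 1:] * ([:0, 1:] * ?b + ?a) + ?b" by simp_all
  have "([:0, 1:] * (t * ?b + ?a) + ?b) * ?b - (t * ?b + ?a)\<^sup>2
      = - ((t * ?b + ?a) * ?a - ?b\<^sup>2)" if "t = [:0, 1:]" for t
    unfolding that[symmetric] by (simp add: power2_eq_square algebra_simps)
  note this[OF refl]
  also have "([:0, 1:] * ?b + ?a) * ?a - ?b\<^sup>2 = (- 1) ^ Suc k" using Suc unfolding * .
  finally show ?case unfolding * by (simp only: power_Suc mult_minus1)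
qed simp

text \<open>The equation is x = (D x^r - B) / (A - B x^r) without denominators. By the determinant
  identity two values of the right-hand side differ by (x^r - y^r) / (den x * den y). The numerator
  is (x - y)^r, and both denominators have the size of A.\<close>

lemma exists_fixed_laurent:
  fixes A B D :: "'a::{finite,field} poly"
  assumes det: "A * D - B\<^sup>2 = 1" and deg: "degree B < degree A" "degree D < degree A"
    and r: "r \<ge> 1" and frob: "\<And>x y :: 'a fls. (x + y) ^ r = x ^ r + y ^ r"
  defines "T \<equiv> T_poly_to_fls"
  shows "\<exists>alpha. fls_absval alpha < 1 \<and> alpha * (T A - T B * alpha ^ r) = T D * alpha ^ r - T B"
proof -
  define b where "b = base TYPE('a)"
  have b: "b > 1" using card_field_gt_1[where 'a='a] by (simp add: b_def)
  have A: "fls_absval (T A) = b ^ degree A" "fls_absval (T A) \<ge> b" 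
    using deg b power_increasing[of 1 "degree A" b]
    by (auto simp: T_def abv_T_poly_to_fls Tpoly_absval_def b_def)
  have lt: "fls_absval (T C) < fls_absval (T A)" if "degree C < degree A" for C
    using that b by (auto simp: T_def abv_T_poly_to_fls Tpoly_absval_def b_def)
  have small: "fls_absval (T C * x ^ r) < fls_absval (T A)"
    if "degree C < degree A" "fls_absval x < 1" for C x
  proof -
    have "fls_absval (x ^ r) \<le> 1" using that by (simp add: abv_power power_le_one)
    hence "fls_absval (T C * x ^ r) \<le> fls_absval (T C)" by (simp add: abv_mult mult_left_le)
    thus ?thesis using lt[OF that(1)] by simp
  qed
  define den where "den x = T A - T B * x ^ r" for x
  define G where "G x = (T D * x ^ r - T B) / den x" for x
  have den: "fls_absval (den x) = fls_absval (T A)" if "fls_absval x < 1" for x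
    unfolding den_def using small[OF deg(1) that] by (rule abv_diff_eq)
  have den0: "den x \<noteq> 0" if "fls_absval x < 1" for x
    using den[OF that] A b by (metis abv_0 not_one_le_zero less_le_trans less_eq_real_def linorder_not_le zero_less_one)
  have detT: "T A * T D - (T B)\<^sup>2 = 1"
    using arg_cong[OF det, of T] unfolding T_def
    by (simp add: T.e_diff T.e_mult T.e_power T.e_1)
  have "\<exists>x. fls_absval x < 1 \<and> G x = x"
  proof (rule fls_contraction_fixpoint)
    fix x :: "'a fls" assume x: "fls_absval x < 1"
    have "fls_absval (T D * x ^ r - T B) < fls_absval (T A)"
      using abv_diff_le[of "T D * x ^ r" "T B"] small[OF deg(2) x] lt[OF deg(1)] by simp
    thus "fls_absval (G x) < 1" using A b by (simp add: G_def abv_divide den x)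
    fix y :: "'a fls" assume y: "fls_absval y < 1"
    \<comment> \<open>Additivity applied to (x - y) + y avoids determining the sign of
      (-1)^r.\<close>
    have "(x - y + y) ^ r = (x - y) ^ r + y ^ r" by (rule frob)
    hence xy: "x ^ r - y ^ r = (x - y) ^ r" by simp
    have "G x - G y = ((T D * x ^ r - T B) * den y - (T D * y ^ r - T B) * den x) / (den x * den y)"
      using den0[OF x] den0[OF y] by (simp add: G_def divide_simps)
    also have "(T D * x ^ r - T B) * den y - (T D * y ^ r - T B) * den x
       = (T A * T D - (T B)\<^sup>2) * (x ^ r - y ^ r)"
      by (simp add: den_def algebra_simps power2_eq_square)
    finally have "fls_absval (G x - G y) = fls_absval (x - y) ^ r / (fls_absval (T A))\<^sup>2"
      by (simp add: detT xy abv_divide abv_mult abv_power den x y flip: power2_eq_square)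
    also have "\<dots> \<le> fls_absval (x - y) / b"
    proof (rule frac_le)
      have "fls_absval (x - y) < 1" using abv_diff_le[of x y] x y by simp
      thus "fls_absval (x - y) ^ r \<le> fls_absval (x - y)"
        using power_decreasing[of 1 r "fls_absval (x - y)"] r by simp
      show "b \<le> (fls_absval (T A))\<^sup>2" using A(2) b
        by (smt (verit) power2_eq_square mult_le_cancel_left1)
    qed (use b in auto)
    finally show "fls_absval (G x - G y) \<le> fls_absval (x - y) / base TYPE('a)" by (simp add: b_def)
  qed
  then obtain x where x: "fls_absval x < 1" "G x = x" by blast
  hence "x * den x = T D * x ^ r - T B" using den0[OF x(1)] by (simp add: G_def divide_simps)
  thus ?thesis using x(1) by (auto simp: den_def)
qed

section \<open>The quadratic approximations\<close>

lemma height_ge: "Tpoly_absval (coeff P i) \<le> height (P :: 'a::{finite,field} poly poly)"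
proof (cases "i \<le> degree P")
  case True
  thus ?thesis unfolding height_def by (intro Max_ge) auto
next
  case False
  have "Tpoly_absval (coeff P 0) \<le> height P" unfolding height_def by (intro Max_ge) auto
  thus ?thesis using False Tpoly_absval_nonneg[of "coeff P 0"] 
    by (simp add: coeff_eq_0 Tpoly_absval_def[of 0] order_trans[of 0 "Tpoly_absval (coeff P 0)"])
qed

lemma height_le: "(\<And>i. Tpoly_absval (coeff P i) \<le> x) \<Longrightarrow> height P \<le> x"
  unfolding height_def by (subst Max_le_iff) auto

lemma height_ge_1: "P \<noteq> 0 \<Longrightarrow> height P \<ge> 1"
  using height_ge[of P "degree P"] Tpoly_absval_ge_1[of "lead_coeff P"] by simp

text \<open>For a form of degree 2 this means that it is irreducible and primitive over \<open>F_q[T]\<close>.\<close>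

definition anisotropic :: "'a::field poly \<Rightarrow> 'a poly \<Rightarrow> 'a poly \<Rightarrow> bool" where
  "anisotropic a b c \<longleftrightarrow> (\<forall>u v. a * u\<^sup>2 + b * u * v + c * v\<^sup>2 = 0 \<longrightarrow> u = 0 \<and> v = 0)
     \<and> (\<forall>d. d dvd a \<longrightarrow> d dvd b \<longrightarrow> d dvd c \<longrightarrow> is_unit d)"

text \<open>For a coprime zero (u, v) the equation makes u and v divide each other, so both are
  constants, and then k u v = v^2 - u^2 contradicts the degree of k. A general k is needed because
  the forms are later twisted by powers of Frobenius, which turn T into a power of T.\<close>

lemma anisotropic_unit_form:
  fixes k :: "'a::field poly"
  assumes k: "degree k \<ge> 1"
  shows "anisotropic 1 k (-1)"
proof -
  have coprime_case: False 
    if eq: "u * u + k * u * v = v * v" and bez: "s * u + t * v = 1" for u v s t :: "'a poly"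
  proof -
    have uvv: "v * v = u * (u + k * v)" unfolding eq[symmetric] by (simp add: algebra_simps)
    have vuu: "u * u = v * (v - k * u)" using eq by (simp add: algebra_simps)
    have "v = (s * u + t * v) * v" by (simp add: bez)
    also have "\<dots> = s * u * v + t * (v * v)" by (simp add: algebra_simps)
    also have "\<dots> = u * (s * v + t * (u + k * v))" unfolding uvv by (simp add: algebra_simps)
    finally have "u dvd v" by (rule dvdI)
    have "u = (s * u + t * v) * u" by (simp add: bez)
    also have "\<dots> = s * (u * u) + t * v * u" by (simp add: algebra_simps)
    also have "\<dots> = v * (s * (v - k * u) + t * u)" unfolding vuu by (simp add: algebra_simps)
    finally have "v dvd u" by (rule dvdI)
    have "u dvd s * u + t * v" using \<open>u dvd v\<close> by simp
    hence "u dvd 1" by (simp only: bez)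
    hence "v dvd 1" using \<open>v dvd u\<close> dvd_trans by blast
    have deg: "degree u = 0" "degree v = 0" "u \<noteq> 0" "v \<noteq> 0"
      using \<open>u dvd 1\<close> \<open>v dvd 1\<close> by (auto elim!: is_unit_polyE)
    have "k * u * v = v * v - u * u" using eq by (simp add: algebra_simps)
    hence "degree (k * u * v) = degree (v * v - u * u)" by simp
    also have "\<dots> \<le> 0" using deg degree_diff_le_max[of "v * v" "u * u"] by (simp add: degree_mult_eq)
    finally have "degree (k * u * v) = 0" by simp
    moreover have "k \<noteq> 0" using k by auto
    ultimately show False using deg k by (simp add: degree_mult_eq)
  qed
  \<comment> \<open>Euclid's algorithm, phrased so that the common factor \<open>g\<close> and the
    Bezout coefficients of the coprime parts come out together.\<close>
  have bezout: "\<exists>g u' v' s t. u = g * u' \<and> v = g * v' \<and> s * u' + t * v' = 1 \<and> g \<noteq> 0"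
    if "v \<noteq> 0" for u v :: "'a poly"
    using that
  proof (induction "degree v" arbitrary: u v rule: less_induct)
    case less
    show ?case
    proof (cases "u mod v = 0")
      case True
      hence "u = v * (u div v) \<and> v = v * 1 \<and> 0 * (u div v) + 1 * 1 = (1 :: 'a poly) \<and> v \<noteq> 0"
        using less.prems by auto
      thus ?thesis by blast
    next
      case False
      have "degree (u mod v) < degree v" using False degree_mod_less less.prems by blast
      from less.hyps[OF this False, of v]
      obtain g u' v' s t where *: "v = g * u'" "u mod v = g * v'" "s * u' + t * v' = 1" "g \<noteq> 0" by blast
      have "u = u div v * v + u mod v" by simp
      also have "\<dots> = g * (u div v * u' + v')" using * by (simp add: algebra_simps)
      finally have "u = g * (u div v * u' + v')" .
      moreover have "t * (u div v * u' + v') + (s - t * (u div v)) * u' = 1"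
        using *(3) by (simp add: algebra_simps)
      ultimately show ?thesis using * by blast
    qed
  qed
  have "u = 0 \<and> v = 0" if eq: "1 * u\<^sup>2 + k * u * v + -1 * v\<^sup>2 = 0" for u v
  proof (cases "v = 0")
    case False
    then obtain g u' v' s t where *: "u = g * u'" "v = g * v'" "s * u' + t * v' = 1" "g \<noteq> 0"
      using bezout by blast
    have "g\<^sup>2 * (u' * u' + k * u' * v' - v' * v') = 0"
      using eq * by (simp add: power2_eq_square algebra_simps)
    hence "u' * u' + k * u' * v' = v' * v'" using * by simp
    thus ?thesis using coprime_case * by blast
  qed (use eq in auto)
  thus ?thesis unfolding anisotropic_def by blast
qed

text \<open>A substitution of determinant 1 is invertible over F_q[T]: zeros of the new form come
  from zeros of the old one, and a common divisor of the new coefficients divides the old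
  ones.\<close>

lemma anisotropic_unimodular:
  fixes a b c :: "'a::field poly"
  assumes f: "anisotropic a b c" and det: "A * D - B\<^sup>2 = 1"
  shows "anisotropic (a * A\<^sup>2 + b * A * B + c * B\<^sup>2)
    (a * A * B + a * A * B + b * (A * D + B\<^sup>2) + (c * B * D + c * B * D))
    (a * B\<^sup>2 + b * B * D + c * D\<^sup>2)" (is "anisotropic ?a ?b ?c")
  unfolding anisotropic_def
proof (intro conjI allI impI)
  fix u v assume eq: "?a * u\<^sup>2 + ?b * u * v + ?c * v\<^sup>2 = 0"
  have "a * (A * u + B * v)\<^sup>2 + b * (A * u + B * v) * (B * u + D * v) + c * (B * u + D * v)\<^sup>2 = 0"
    unfolding eq[symmetric] by (simp add: algebra_simps power2_eq_square)
  hence *: "A * u + B * v = 0" "B * u + D * v = 0" using f unfolding anisotropic_def by blast+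
  have "1 * u = D * (A * u + B * v) - B * (B * u + D * v)"
    "1 * v = A * (B * u + D * v) - B * (A * u + B * v)"
    unfolding det[symmetric] by (simp_all add: algebra_simps power2_eq_square)
  thus "u = 0" "v = 0" unfolding * by simp_all
next
  fix d assume d: "d dvd ?a" "d dvd ?b" "d dvd ?c"
  \<comment> \<open>The inverse substitution applied to the new form. The square of the determinant
    is kept symbolic, so these are plain polynomial identities.\<close>
  have 1: "(A * D - B\<^sup>2)\<^sup>2 * a = D\<^sup>2 * ?a - B * D * ?b + B\<^sup>2 * ?c"
    "(A * D - B\<^sup>2)\<^sup>2 * b = (A * D + B\<^sup>2) * ?b - 2 * B * D * ?a - 2 * A * B * ?c"
    "(A * D - B\<^sup>2)\<^sup>2 * c = B\<^sup>2 * ?a - A * B * ?b + A\<^sup>2 * ?c"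
    by (simp_all add: algebra_simps power2_eq_square)
  have "d dvd D\<^sup>2 * ?a - B * D * ?b + B\<^sup>2 * ?c" 
    "d dvd (A * D + B\<^sup>2) * ?b - 2 * B * D * ?a - 2 * A * B * ?c"
    "d dvd B\<^sup>2 * ?a - A * B * ?b + A\<^sup>2 * ?c"
    by (intro dvd_add dvd_diff dvd_mult d)+
  hence "d dvd a" "d dvd b" "d dvd c" unfolding 1[symmetric] det by simp_all
  thus "is_unit d" using f unfolding anisotropic_def by blast
qed

text \<open>The matrix with rows (A, B) and (B, D) is the inverse of N, so alpha^r = (A alpha + B) /
  (B alpha + D). Together with \<open>det\<close>, the relation \<open>D_eq\<close> says that this
  substitution preserves X^2 + T X Y - Y^2.\<close>

locale quadratic_approximations =
  fixes r L :: nat and A B D :: "'a::{finite,field} poly" and alpha :: "'a fls"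
  assumes r: "r \<ge> 2"
    and frob_poly: "\<And>x y :: 'a poly. (x + y) ^ r = x ^ r + y ^ r"
    and frob_fls: "\<And>x y :: 'a fls. (x + y) ^ r = x ^ r + y ^ r"
    and L_eq: "L = 2 * r\<^sup>2"
    and D_eq: "D = A + [:0, 1:] * B"
    and det: "A * D - B\<^sup>2 = 1"
    and degree_A: "degree A = L" and degree_B: "degree B = L - 1" and degree_D: "degree D \<le> L - 2"
    and alpha_small: "fls_absval alpha < 1"
    and alpha_eq: "alpha * (T_poly_to_fls A - T_poly_to_fls B * alpha ^ r)
                   = T_poly_to_fls D * alpha ^ r - T_poly_to_fls B"
begin

text \<open>The coefficients (a, b, c) of P_j: the coefficients of P_(j-1) are raised to the power r and then
  X, Y are replaced by A X + B Y, B X + D Y. Doubled terms are written as sums so that the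
  r-th power map, which is additive, commutes with the formulas without computing 2^r.\<close>

fun coefs :: "nat \<Rightarrow> 'a poly \<times> 'a poly \<times> 'a poly" where
  "coefs 0 = (1, [:0, 1:], -1)"
| "coefs (Suc j) = (case coefs j of (a, b, c) \<Rightarrow>
     (a ^ r * A\<^sup>2 + b ^ r * A * B + c ^ r * B\<^sup>2,
      a ^ r * A * B + a ^ r * A * B + b ^ r * (A * D + B\<^sup>2) + (c ^ r * B * D + c ^ r * B * D),
      a ^ r * B\<^sup>2 + b ^ r * B * D + c ^ r * D\<^sup>2))"

definition ca where "ca j = fst (coefs j)"
definition cb where "cb j = fst (snd (coefs j))"
definition cc where "cc j = snd (snd (coefs j))"

lemma ca_0: "ca 0 = 1" and cb_0: "cb 0 = [:0, 1:]" and cc_0: "cc 0 = -1"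
  by (simp_all add: ca_def cb_def cc_def)

lemma ca_Suc: "ca (Suc j) = ca j ^ r * A\<^sup>2 + cb j ^ r * A * B + cc j ^ r * B\<^sup>2"
  and cb_Suc: "cb (Suc j) = ca j ^ r * A * B + ca j ^ r * A * B + cb j ^ r * (A * D + B\<^sup>2)
     + (cc j ^ r * B * D + cc j ^ r * B * D)"
  and cc_Suc: "cc (Suc j) = ca j ^ r * B\<^sup>2 + cb j ^ r * B * D + cc j ^ r * D\<^sup>2"
  by (simp_all add: ca_def cb_def cc_def case_prod_unfold)

lemma frob_poly_uminus: "(- x :: 'a poly) ^ r = - (x ^ r)"
proof -
  have "x ^ r + (- x) ^ r = 0" using frob_poly[of x "- x"] r by (simp add: power_0_left)
  thus ?thesis using minus_unique by metis
qed

lemma frob_poly_diff: "(x - y :: 'a poly) ^ r = x ^ r - y ^ r"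
  using frob_poly[of x "- y"] by (simp add: frob_poly_uminus)

lemma frob_poly_power: "(x + y :: 'a poly) ^ (r ^ k) = x ^ (r ^ k) + y ^ (r ^ k)"
  by (induction k) (simp_all add: power_mult frob_poly mult.commute[of r])

lemma frob_poly_power_minus_1: "(-1 :: 'a poly) ^ (r ^ k) = -1"
  by (induction k) (simp_all add: power_mult frob_poly_uminus mult.commute[of r])

text \<open>A step of the recursion twists by the r-th power map, so the induction needs all twists of P_j.\<close>

lemma anisotropic_coefs: "anisotropic (ca j) (cb j) (cc j)"
proof -
  have "anisotropic (ca j ^ (r ^ k)) (cb j ^ (r ^ k)) (cc j ^ (r ^ k))" for k
  proof (induction j arbitrary: k)
    case 0
    have "degree ([:0, 1 :: 'a:] ^ (r ^ k)) \<ge> 1"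
      using r by (simp add: degree_power_eq Suc_leI)
    thus ?case by (simp add: ca_0 cb_0 cc_0 frob_poly_power_minus_1 anisotropic_unit_form)
  next
    case (Suc j)
    let ?R = "r ^ k"
    have det': "A ^ ?R * D ^ ?R - (B ^ ?R)\<^sup>2 = 1"
    proof -
      have "A * D = 1 + B\<^sup>2" using det by (simp add: algebra_simps)
      hence "(A * D) ^ ?R = 1 + (B\<^sup>2) ^ ?R" by (simp add: frob_poly_power)
      thus ?thesis by (simp add: power_mult_distrib power_mult[symmetric] mult.commute)
    qed
    have pp: "(x ^ r) ^ ?R = x ^ (r ^ Suc k)" "(x\<^sup>2) ^ ?R = (x ^ ?R)\<^sup>2" for x :: "'a poly"
      by (simp_all add: power_mult[symmetric] mult.commute)
    show ?case
      using anisotropic_unimodular[OF Suc.IH[of "Suc k"] det']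
      unfolding ca_Suc cb_Suc cc_Suc by (simp only: frob_poly_power power_mult_distrib pp)
  qed
  from this[of 0] show ?thesis by simp
qed

text \<open>The substitution has determinant 1 and leaves the discriminant alone; only Frobenius
  acts on it. So disc P_j = (T^2 + 4)^(r^j), with no contribution from A, B, D, unlike the
  height.\<close>

lemma disc_Suc: "(cb (Suc j))\<^sup>2 - 4 * ca (Suc j) * cc (Suc j) = ((cb j)\<^sup>2 - 4 * ca j * cc j) ^ r"
proof -
  let ?a = "ca j ^ r" and ?b = "cb j ^ r" and ?c = "cc j ^ r"
  have "(cb (Suc j))\<^sup>2 - 4 * ca (Suc j) * cc (Suc j) = (?b\<^sup>2 - 4 * ?a * ?c) * (A * D - B\<^sup>2)\<^sup>2"
    unfolding ca_Suc cb_Suc cc_Suc by (simp add: algebra_simps power2_eq_square)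
  \<comment> \<open>The multiple by 4 is spelled out as a sum, so that additivity of the r-th power
    applies.\<close>
  also have "\<dots> = ?b\<^sup>2 - (?a * ?c + ?a * ?c + ?a * ?c + ?a * ?c)" by (simp add: det)
  also have "\<dots> = ((cb j)\<^sup>2 - (ca j * cc j + ca j * cc j + ca j * cc j + ca j * cc j)) ^ r"
    by (simp only: frob_poly frob_poly_diff power_mult_distrib power2_eq_square)
  also have "ca j * cc j + ca j * cc j + ca j * cc j + ca j * cc j = 4 * ca j * cc j" by simp
  finally show ?thesis .
qed

lemma degree_disc: "degree ((cb j)\<^sup>2 - 4 * ca j * cc j) \<le> 2 * r ^ j"
proof (induction j)
  case 0
  have "degree ([:0, 1 :: 'a:]\<^sup>2 - 4 * 1 * (-1)) \<le> 2"
    by (intro degree_diff_le) (auto simp: degree_power_eq)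
  thus ?case by (simp add: ca_0 cb_0 cc_0)
next
  case (Suc j)
  have "degree (((cb j)\<^sup>2 - 4 * ca j * cc j) ^ r) \<le> degree ((cb j)\<^sup>2 - 4 * ca j * cc j) * r"
    by (rule degree_power_le)
  also have "\<dots> \<le> 2 * r ^ j * r" using Suc by simp
  finally show ?case unfolding disc_Suc by (simp add: mult_ac)
qed

lemma L_ge: "L \<ge> 8" "L \<ge> 2 * r"
proof -
  have "r * r \<ge> 2 * 2" "r * r \<ge> 2 * r" using r by (intro mult_le_mono; simp)+
  thus "L \<ge> 8" "L \<ge> 2 * r" by (simp_all add: L_eq power2_eq_square)
qed

lemma A_nz: "A \<noteq> 0" and B_nz: "B \<noteq> 0"
  using degree_A degree_B L_ge by auto

lemma degree_mult_bound: "degree (x :: 'a poly) \<le> m \<Longrightarrow> degree y \<le> k \<Longrightarrow> degree (x * y) \<le> m + k"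
  using degree_mult_le[of x y] by linarith

lemma degree_power_bound: "degree (x :: 'a poly) \<le> m \<Longrightarrow> degree (x ^ k) \<le> m * k"
  by (meson degree_power_le mult_le_mono1 order_trans)

text \<open>The first step differs from the later ones: in P_0 the middle coefficient T is the
  largest, so here T^r A B dominates. The leading coefficient is the strictly largest one only from
  P_1 on.\<close>

lemma degree_coefs_1:
  "degree (ca 1) = r + 2 * L - 1 \<and> degree (cb 1) < degree (ca 1) \<and> degree (cc 1) < degree (ca 1)"
proof -
  \<comment> \<open>This removes the truncated subtractions \<open>L - 1\<close> and
    \<open>L - 2\<close>.\<close>
  obtain l where l: "L = l + 2" using L_ge le_Suc_ex[of 2 L] by (auto simp: add.commute)
  have dA: "degree A \<le> l + 2" and dB: "degree B \<le> l + 1" and dD: "degree D \<le> l"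
    using degree_A degree_B degree_D by (simp_all add: l)
  have Tr: "degree ([:0, 1 :: 'a:] ^ r) = r" by (simp add: degree_power_eq)
  have m: "degree ((-1 :: 'a poly) ^ r) \<le> 0" using degree_power_bound[of "-1 :: 'a poly" 0 r] by simp
  have AA: "degree (A\<^sup>2) \<le> 2 * l + 4" and BB: "degree (B\<^sup>2) \<le> 2 * l + 2" and DD: "degree (D\<^sup>2) \<le> 2 * l"
    and AB: "degree (A * B) \<le> 2 * l + 3" and AD: "degree (A * D) \<le> 2 * l + 2" and BD: "degree (B * D) \<le> 2 * l + 1"
    using degree_power_bound[OF dA, of 2] degree_power_bound[OF dB, of 2] degree_power_bound[OF dD, of 2]
      degree_mult_bound[OF dA dB] degree_mult_bound[OF dA dD] degree_mult_bound[OF dB dD]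
    by simp_all
  have TAB: "degree ([:0, 1:] ^ r * A * B) = r + 2 * l + 3"
    using A_nz B_nz by (simp add: degree_mult_eq Tr degree_A degree_B l)
  have small: "degree (A\<^sup>2 + (-1) ^ r * B\<^sup>2) < r + 2 * l + 3"
  proof -
    have "degree (A\<^sup>2 + (-1) ^ r * B\<^sup>2) \<le> 2 * l + 4"
      using AA degree_mult_bound[OF m BB] by (intro degree_add_le; linarith)
    thus ?thesis using r by linarith
  qed
  have "ca 1 = [:0, 1:] ^ r * A * B + (A\<^sup>2 + (-1) ^ r * B\<^sup>2)"
    using ca_Suc[of 0] by (simp add: ca_0 cb_0 cc_0)
  hence 1: "degree (ca 1) = r + 2 * l + 3"
    using small TAB by (simp add: degree_add_eq_left)
  have 2: "degree (cb 1) \<le> r + 2 * l + 2"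
  proof -
    have "cb 1 = A * B + A * B + [:0, 1:] ^ r * (A * D + B\<^sup>2) + ((-1) ^ r * (B * D) + (-1) ^ r * (B * D))"
      using cb_Suc[of 0] by (simp add: ca_0 cb_0 cc_0 mult.assoc)
    also have "degree \<dots> \<le> r + 2 * l + 2"
    proof (intro degree_add_le)
      show "degree (A * B) \<le> r + 2 * l + 2" "degree (A * B) \<le> r + 2 * l + 2" using AB r by linarith+
      have "degree (A * D + B\<^sup>2) \<le> 2 * l + 2" using AD BB by (intro degree_add_le) linarith+
      from degree_mult_bound[OF _ this, of "[:0, 1:] ^ r" r]
      show "degree ([:0, 1:] ^ r * (A * D + B\<^sup>2)) \<le> r + 2 * l + 2" using Tr by linarith
      show "degree ((-1) ^ r * (B * D)) \<le> r + 2 * l + 2" "degree ((-1) ^ r * (B * D)) \<le> r + 2 * l + 2"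
        using degree_mult_bound[OF m BD] by linarith+
    qed
    finally show ?thesis .
  qed
  have 3: "degree (cc 1) \<le> r + 2 * l + 2"
  proof -
    have "cc 1 = B\<^sup>2 + [:0, 1:] ^ r * (B * D) + (-1) ^ r * D\<^sup>2"
      using cc_Suc[of 0] by (simp add: ca_0 cb_0 cc_0 mult.assoc)
    also have "degree \<dots> \<le> r + 2 * l + 2"
    proof (intro degree_add_le)
      show "degree (B\<^sup>2) \<le> r + 2 * l + 2" using BB by linarith
      show "degree ([:0, 1:] ^ r * (B * D)) \<le> r + 2 * l + 2"
        using degree_mult_bound[OF order.refl BD, of "[:0, 1:] ^ r"] Tr by linarith
      show "degree ((-1) ^ r * D\<^sup>2) \<le> r + 2 * l + 2"
        using degree_mult_bound[OF m DD] by linarith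
    qed
    finally show ?thesis .
  qed
  show ?thesis using 1 2 3 by (simp add: l)
qed

text \<open>Since A has larger degree than B and D, the product a^r A^2 strictly dominates all other
  terms, and the dominance of the leading coefficient reproduces itself.\<close>

lemma degree_coefs_Suc:
  assumes "degree (cb j) < degree (ca j)" "degree (cc j) < degree (ca j)"
  shows "degree (ca (Suc j)) = r * degree (ca j) + 2 * L
    \<and> degree (cb (Suc j)) < degree (ca (Suc j)) \<and> degree (cc (Suc j)) < degree (ca (Suc j))"
proof -
  obtain h where h: "degree (ca j) = Suc h" using assms by (cases "degree (ca j)") auto
  have bc: "degree (cb j) \<le> h" "degree (cc j) \<le> h" using assms by (auto simp: h)
  have a_nz: "ca j \<noteq> 0" using assms by auto
  obtain l where l: "L = l + 2" using L_ge le_Suc_ex[of 2 L] by (auto simp: add.commute)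
  have dA: "degree A \<le> l + 2" and dB: "degree B \<le> l + 1" and dD: "degree D \<le> l"
    using degree_A degree_B degree_D by (simp_all add: l)
  have BB: "degree (B\<^sup>2) \<le> 2 * l + 2" and DD: "degree (D\<^sup>2) \<le> 2 * l"
    and AB: "degree (A * B) \<le> 2 * l + 3" and AD: "degree (A * D) \<le> 2 * l + 2" and BD: "degree (B * D) \<le> 2 * l + 1"
    using degree_power_bound[OF dB, of 2] degree_power_bound[OF dD, of 2]
      degree_mult_bound[OF dA dB] degree_mult_bound[OF dA dD] degree_mult_bound[OF dB dD]
    by simp_all
  define N where "N = h * r + r + 2 * l + 3"
  have ar: "degree (ca j ^ r) = h * r + r" by (simp add: degree_power_eq a_nz h)
  note br = degree_power_bound[OF bc(1), of r] and cr = degree_power_bound[OF bc(2), of r]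
  have main: "degree (ca j ^ r * A\<^sup>2) = Suc N"
    using a_nz A_nz by (simp add: degree_mult_eq ar degree_power_eq degree_A l N_def)
  have "degree (cb j ^ r * (A * B) + cc j ^ r * B\<^sup>2) \<le> N"
    using degree_mult_bound[OF br AB] degree_mult_bound[OF cr BB] unfolding N_def
    by (intro degree_add_le; linarith)
  hence 1: "degree (ca (Suc j)) = Suc N"
    using main by (simp add: ca_Suc add.assoc mult.assoc degree_add_eq_left)
  have "cb (Suc j) = ca j ^ r * (A * B) + ca j ^ r * (A * B) + cb j ^ r * (A * D + B\<^sup>2)
      + (cc j ^ r * (B * D) + cc j ^ r * (B * D))" by (simp add: cb_Suc mult.assoc)
  also have "degree \<dots> \<le> N"
  proof (intro degree_add_le)
    show "degree (ca j ^ r * (A * B)) \<le> N" "degree (ca j ^ r * (A * B)) \<le> N"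
      using degree_mult_bound[OF eq_refl[OF ar] AB] unfolding N_def by linarith+
    have "degree (A * D + B\<^sup>2) \<le> 2 * l + 2" using AD BB by (intro degree_add_le) linarith+
    from degree_mult_bound[OF br this]
    show "degree (cb j ^ r * (A * D + B\<^sup>2)) \<le> N" unfolding N_def by linarith
    show "degree (cc j ^ r * (B * D)) \<le> N" "degree (cc j ^ r * (B * D)) \<le> N"
      using degree_mult_bound[OF cr BD] unfolding N_def by linarith+
  qed
  finally have 2: "degree (cb (Suc j)) \<le> N" .
  have "cc (Suc j) = ca j ^ r * B\<^sup>2 + cb j ^ r * (B * D) + cc j ^ r * D\<^sup>2" by (simp add: cc_Suc mult.assoc)
  also have "degree \<dots> \<le> N"
  proof (intro degree_add_le)
    show "degree (ca j ^ r * B\<^sup>2) \<le> N"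
      using degree_mult_bound[OF eq_refl[OF ar] BB] unfolding N_def by linarith
    show "degree (cb j ^ r * (B * D)) \<le> N"
      using degree_mult_bound[OF br BD] unfolding N_def by linarith
    show "degree (cc j ^ r * D\<^sup>2) \<le> N"
      using degree_mult_bound[OF cr DD] unfolding N_def by linarith
  qed
  finally have 3: "degree (cc (Suc j)) \<le> N" .
  show ?thesis using 1 2 3 by (simp add: h l N_def algebra_simps)
qed

text \<open>The logarithm to base q of the height of P_(j+1). The shift skips P_0, whose leading
  coefficient is not dominant.\<close>

definition ht :: "nat \<Rightarrow> nat" where "ht j = degree (ca (Suc j))"

lemma ht_0: "ht 0 = r + 2 * L - 1"
  using degree_coefs_1 by (simp add: ht_def)

lemma degree_cb_cc: "degree (cb (Suc j)) < ht j" "degree (cc (Suc j)) < ht j"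
proof -
  have "degree (cb (Suc j)) < degree (ca (Suc j)) \<and> degree (cc (Suc j)) < degree (ca (Suc j))"
  proof (induction j)
    case 0
    show ?case using degree_coefs_1 by simp
  next
    case (Suc j)
    thus ?case using degree_coefs_Suc[of "Suc j"] by blast
  qed
  thus "degree (cb (Suc j)) < ht j" "degree (cc (Suc j)) < ht j" by (simp_all add: ht_def)
qed

lemma ht_Suc: "ht (Suc j) = r * ht j + 2 * L"
  using degree_coefs_Suc[of "Suc j"] degree_cb_cc[of j] by (simp add: ht_def)

text \<open>A crude comparison that suffices: it makes the square root of the discriminant at most
  the square root of the height.\<close>

lemma degree_disc_le: "degree ((cb (Suc j))\<^sup>2 - 4 * ca (Suc j) * cc (Suc j)) \<le> ht j"
proof -
  have "2 * r ^ Suc j \<le> ht j"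
  proof (induction j)
    case 0
    show ?case using L_ge by (simp add: ht_0)
  next
    case (Suc j)
    hence "r * (2 * r ^ Suc j) \<le> r * ht j" by (rule mult_le_mono2)
    hence "r * (2 * r ^ Suc j) \<le> r * ht j + 2 * L" by (rule trans_le_add1)
    moreover have "2 * r ^ Suc (Suc j) = r * (2 * r ^ Suc j)" by simp
    ultimately show ?case unfolding ht_Suc by (simp only:)
  qed
  thus ?thesis using degree_disc[of "Suc j"] by linarith
qed

end

section \<open>The size of the quadratic forms at alpha\<close>

context quadratic_approximations
begin

abbreviation \<tau> :: "'a poly \<Rightarrow> 'a fls" where "\<tau> \<equiv> T_poly_to_fls"

lemma base_gt_1: "base TYPE('a) > 1"
  by (rule card_field_gt_1)

lemmas tau_simps = T.e_add T.e_mult T.e_diff T.e_power T.e_minus T.e_1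

lemma abv_tau: "P \<noteq> 0 \<Longrightarrow> fls_absval (\<tau> P) = base TYPE('a) ^ degree P"
  by (simp add: abv_T_poly_to_fls Tpoly_absval_def)

text \<open>The automorphy factor of the inverse of N at alpha: the denominator in alpha^r = (A
  alpha + B) / (B alpha + D).\<close>

definition lam where "lam = \<tau> B * alpha + \<tau> D"

lemma lam_mult_alpha: "\<tau> A * alpha + \<tau> B = lam * alpha ^ r"
  using alpha_eq by (simp add: lam_def algebra_simps)

lemma det_tau: "\<tau> A * \<tau> D - (\<tau> B)\<^sup>2 = 1"
  using arg_cong[OF det, of \<tau>] by (simp add: tau_simps)

text \<open>The two summands of \<open>lam\<close> almost cancel, so its size cannot be read off
  from them. The inverse of \<open>lam\<close> has the single dominant term A.\<close>

lemma lam_mult: "lam * (\<tau> A - \<tau> B * alpha ^ r) = 1"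
proof -
  have "lam * (\<tau> A - \<tau> B * alpha ^ r) = \<tau> A * lam - \<tau> B * (\<tau> A * alpha + \<tau> B)"
    unfolding lam_mult_alpha by (simp add: algebra_simps)
  also have "\<dots> = \<tau> A * \<tau> D - (\<tau> B)\<^sup>2" by (simp add: lam_def algebra_simps power2_eq_square)
  finally show ?thesis by (simp add: det_tau)
qed

lemma abv_lam: "fls_absval lam = 1 / base TYPE('a) ^ L"
proof -
  have "fls_absval (\<tau> B * alpha ^ r) \<le> fls_absval (\<tau> B)"
    using alpha_small by (simp add: abv_mult abv_power mult_left_le power_le_one)
  also have "\<dots> < base TYPE('a) ^ L" using L_ge base_gt_1 by (simp add: abv_tau B_nz degree_B)
  also have "\<dots> = fls_absval (\<tau> A)" by (simp add: abv_tau A_nz degree_A)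
  finally have "fls_absval (\<tau> A - \<tau> B * alpha ^ r) = base TYPE('a) ^ L"
    using abv_diff_eq abv_tau[OF A_nz] degree_A by metis
  moreover have "fls_absval lam * fls_absval (\<tau> A - \<tau> B * alpha ^ r) = 1"
    by (simp only: abv_mult[symmetric] lam_mult abv_1)
  ultimately show ?thesis using base_gt_1 by (simp add: field_simps)
qed

definition val where "val j = \<tau> (ca j) * alpha\<^sup>2 + \<tau> (cb j) * alpha + \<tau> (cc j)"

text \<open>Substituting and then evaluating at alpha is evaluating at alpha^r, up to lam^2;
  Frobenius then takes the r-th power out of the whole form.\<close>

lemma val_Suc: "val (Suc j) = lam\<^sup>2 * val j ^ r"
proof -
  let ?a = "\<tau> (ca j) ^ r" and ?b = "\<tau> (cb j) ^ r" and ?c = "\<tau> (cc j) ^ r"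
  have "val (Suc j) = ?a * (\<tau> A * alpha + \<tau> B)\<^sup>2
      + ?b * (\<tau> A * alpha + \<tau> B) * (\<tau> B * alpha + \<tau> D) + ?c * (\<tau> B * alpha + \<tau> D)\<^sup>2"
    unfolding val_def ca_Suc cb_Suc cc_Suc tau_simps by (simp add: algebra_simps power2_eq_square)
  also have "\<dots> = lam\<^sup>2 * (?a * (alpha ^ r)\<^sup>2 + ?b * alpha ^ r + ?c)"
    unfolding lam_mult_alpha lam_def[symmetric] by (simp add: algebra_simps power2_eq_square)
  also have "?a * (alpha ^ r)\<^sup>2 + ?b * alpha ^ r + ?c = val j ^ r"
    unfolding val_def frob_fls power_mult_distrib by (simp add: power_mult[symmetric] mult.commute)
  finally show ?thesis .
qed

text \<open>The start of the recursion uses invariance instead: P_0(alpha) = lam^2 P_0(alpha^r), and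
  P_0(alpha^r) has absolute value 1 because its constant term -1 dominates.\<close>

lemma abv_val_0: "fls_absval (val 0) = 1 / base TYPE('a) ^ (2 * L)"
proof -
  define t where "t = \<tau> [:0, 1:]"
  define y where "y = alpha ^ r"
  have tD: "\<tau> D = \<tau> A + t * \<tau> B" unfolding t_def by (subst D_eq) (simp only: tau_simps)
  have dt: "1 = \<tau> A * (\<tau> A + t * \<tau> B) - (\<tau> B)\<^sup>2" using det_tau tD by simp
  have "val 0 = alpha\<^sup>2 + t * alpha - 1" by (simp add: val_def ca_0 cb_0 cc_0 tau_simps t_def)
  also have "\<dots> = (\<tau> A * (\<tau> A + t * \<tau> B) - (\<tau> B)\<^sup>2) * (alpha\<^sup>2 + t * alpha - 1)"
    by (simp add: dt[symmetric])
  also have "\<dots> = (\<tau> A * alpha + \<tau> B)\<^sup>2 + t * (\<tau> A * alpha + \<tau> B) * (\<tau> B * alpha + \<tau> D) - (\<tau> B * alpha + \<tau> D)\<^sup>2"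
    unfolding tD by (simp add: algebra_simps power2_eq_square)
  also have "\<dots> = lam\<^sup>2 * (y\<^sup>2 + t * y - 1)"
    unfolding lam_mult_alpha lam_def[symmetric] y_def by (simp add: algebra_simps power2_eq_square)
  finally have eq: "val 0 = lam\<^sup>2 * (- 1 + y * (y + t))" by (simp add: algebra_simps power2_eq_square)
  have "fls_absval (y * (y + t)) < 1"
  proof (cases "alpha = 0")
    case False
    have t: "fls_absval t = base TYPE('a)" by (simp add: t_def abv_tau)
    \<comment> \<open>The absolute value is discrete, so being below 1 means being at most 1/q. With
      r at least 2, alpha^r is then small enough to outweigh the factor T of size q.\<close>
    have "base TYPE('a) powr (- real_of_int (fls_subdegree alpha)) < base TYPE('a) powr 0"
      using alpha_small False base_gt_1 by (simp add: fls_absval_def)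
    hence "- real_of_int (fls_subdegree alpha) < 0" using base_gt_1 by (simp only: powr_less_cancel_iff)
    hence "fls_subdegree alpha \<ge> 1" by linarith
    hence "base TYPE('a) powr (- real_of_int (fls_subdegree alpha)) \<le> base TYPE('a) powr (-1)"
      using base_gt_1 by (intro powr_mono) auto
    hence "fls_absval alpha \<le> inverse (base TYPE('a))"
      using False base_gt_1 by (simp add: fls_absval_def powr_minus)
    hence "fls_absval y \<le> inverse (base TYPE('a)) ^ r" unfolding y_def abv_power by (rule power_mono) simp
    also have "\<dots> \<le> inverse (base TYPE('a)) ^ 2" using r base_gt_1
      by (intro power_decreasing) (auto simp: inverse_eq_divide)
    finally have y: "fls_absval y \<le> 1 / (base TYPE('a))\<^sup>2" by (simp add: power_one_over inverse_eq_divide)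
    also have "\<dots> < base TYPE('a)" using base_gt_1
      by (smt (verit) divide_le_eq_1_pos one_less_power pos2 )
    finally have "fls_absval (y + t) = base TYPE('a)" using abv_add_eq[of y t] t by (simp add: add.commute)
    hence "fls_absval (y * (y + t)) \<le> 1 / (base TYPE('a))\<^sup>2 * base TYPE('a)"
      using mult_right_mono[OF y, of "base TYPE('a)"] by (simp add: abv_mult)
    also have "\<dots> < 1" using base_gt_1 by (simp add: power2_eq_square)
    finally show ?thesis .
  qed (use r in \<open>simp add: y_def power_0_left\<close>)
  hence "fls_absval (- 1 + y * (y + t)) = 1" by (subst abv_add_eq) simp_all
  thus ?thesis by (simp add: eq abv_mult abv_power abv_lam power_divide power_mult mult.commute)
qed

text \<open>The exponent of 1/q in |P_(j+1)(alpha)|: each step multiplies by r and adds 2 L from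
  lam^2, starting from |P_0(alpha)| = q^(-2 L).\<close>

fun decay :: "nat \<Rightarrow> nat" where
  "decay 0 = r * (2 * L) + 2 * L"
| "decay (Suc j) = r * decay j + 2 * L"

lemma abv_val: "fls_absval (val (Suc j)) = 1 / base TYPE('a) ^ decay j"
proof -
  have lam2: "(fls_absval lam)\<^sup>2 = 1 / base TYPE('a) ^ (2 * L)"
    by (simp add: abv_lam power_divide power_mult mult.commute)
  show ?thesis
  proof (induction j)
    case 0
    show ?case unfolding val_Suc[of 0] abv_mult abv_power abv_val_0 lam2
      by (simp add: power_divide power_add mult.commute flip: power_mult)
  next
    case (Suc j)
    show ?case unfolding val_Suc[of "Suc j"] abv_mult abv_power Suc.IH lam2
      by (simp add: power_divide power_add mult.commute flip: power_mult)
  qed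
qed

text \<open>Here L = 2 r^2 pays off: the base case amounts to (4 r - 1) (r - 1) \<le> 2 L. The slack
  8 L makes the induction close, since r times it covers the increment (4 r - 1) * 2 L.\<close>

lemma decay_ge: "(4 * r - 1) * ht j + 8 * L \<le> 4 * decay j"
proof (induction j)
  case 0
  \<comment> \<open>With r = r' + 2 all subtractions disappear and both sides become polynomials
    with natural coefficients.\<close>
  obtain r' where r': "r = r' + 2" using r le_Suc_ex by (metis add.commute)
  have ht0: "ht 0 = 4 * r'\<^sup>2 + 17 * r' + 17"
    unfolding ht_0 unfolding L_eq unfolding r' by (simp add: power2_eq_square algebra_simps)
  show ?case unfolding ht0 decay.simps unfolding L_eq unfolding r'
    by (simp add: power2_eq_square algebra_simps)
next
  case (Suc j)
  obtain k where k: "4 * r = Suc k" using r by (cases "4 * r") auto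
  hence k': "4 * r - 1 = k" by simp
  have "(4 * r - 1) * ht (Suc j) + 8 * L = r * (k * ht j) + (k * (2 * L) + 8 * L)"
    unfolding k' ht_Suc by (simp add: algebra_simps)
  also have "k * (2 * L) + 8 * L \<le> Suc k * (2 * L) + 8 * L" by simp
  also have "\<dots> = r * (8 * L) + 8 * L" unfolding k[symmetric] by simp
  also have "r * (k * ht j) + (r * (8 * L) + 8 * L) = r * ((4 * r - 1) * ht j + 8 * L) + 8 * L"
    unfolding k' by (simp add: algebra_simps)
  also have "\<dots> \<le> r * (4 * decay j) + 8 * L" using Suc by (intro add_mono mult_le_mono) auto
  finally show ?case by simp
qed

text \<open>The converse bound: |P_(j+1)(alpha)| is no smaller than H^(-r) up to a constant factor,
  which is what keeps the roots away from alpha.\<close>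

lemma decay_le: "decay j \<le> r * ht j + 2 * L"
proof (induction j)
  case 0
  have "2 * L \<le> ht 0" using r by (simp add: ht_0)
  thus ?case by simp
next
  case (Suc j)
  have "r * decay j \<le> r * (r * ht j + 2 * L)" using Suc by (intro mult_le_mono) auto
  thus ?case by (simp add: ht_Suc)
qed

lemma ht_mono: "ht j < ht (Suc j)"
proof -
  have "1 * ht j \<le> r * ht j" using r by (intro mult_le_mono) auto
  thus ?thesis unfolding ht_Suc using L_ge by linarith
qed

lemma strict_mono_ht: "strict_mono ht"
  by (simp add: strict_mono_Suc_iff ht_mono)

lemma ht_ge: "j \<le> ht j"
  using strict_mono_ht strict_mono_imp_increasing by blast

definition approx :: "nat \<Rightarrow> 'a poly poly" where
  "approx j = [:cc (Suc j), cb (Suc j), ca (Suc j):]"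

lemma ca_nz: "ca (Suc j) \<noteq> 0"
  using degree_cb_cc[of j] by (auto simp: ht_def)

lemma degree_approx: "degree (approx j) = 2"
  by (simp add: approx_def ca_nz)

lemma coeff_approx: "coeff (approx j) 0 = cc (Suc j)" "coeff (approx j) (Suc 0) = cb (Suc j)"
    "coeff (approx j) 2 = ca (Suc j)"
  by (simp_all add: approx_def numeral_2_eq_2)

lemma ev_approx: "T.ev (approx j) alpha = val (Suc j)"
  by (simp add: approx_def T.ev_pCons val_def power2_eq_square algebra_simps)

lemma Tpoly_absval_ca: "Tpoly_absval (ca (Suc j)) = base TYPE('a) ^ ht j"
  by (simp add: Tpoly_absval_def ca_nz ht_def)

lemma height_approx: "height (approx j) = base TYPE('a) ^ ht j"
proof (rule antisym)
  show "height (approx j) \<le> base TYPE('a) ^ ht j"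
  proof (rule height_le)
    fix i
    have "degree (coeff (approx j) i) \<le> ht j"
      using degree_cb_cc[of j]
      by (cases "i = 0 \<or> i = 1 \<or> i = 2") 
         (auto simp: coeff_approx coeff_eq_0 degree_approx ht_def)
    thus "Tpoly_absval (coeff (approx j) i) \<le> base TYPE('a) ^ ht j" by (rule Tpoly_absval_le)
  qed
  show "base TYPE('a) ^ ht j \<le> height (approx j)"
    using height_ge[of "approx j" 2] by (simp add: coeff_approx Tpoly_absval_ca)
qed

lemma w_exp_ge:
  assumes "n \<ge> 2"
  shows "ereal (real r - 1 / 4) \<le> w_exp n alpha"
  unfolding w_exp_def
proof (rule Sup_upper, safe intro!: exI[of _ "real r - 1/4"])
  let ?S = "{P. degree P \<le> n \<and> 0 < fls_absval (T.ev P alpha) \<and>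
     fls_absval (T.ev P alpha) \<le> height P powr - (real r - 1 / 4)}"
  assume fin: "finite ?S"
  have "approx j \<in> ?S" for j
  proof -
    have "fls_absval (T.ev (approx j) alpha) = 1 / base TYPE('a) ^ decay j" by (simp add: ev_approx abv_val)
    also have "\<dots> = base TYPE('a) powr (- real (decay j))" using base_gt_1
      by (simp add: powr_minus powr_realpow inverse_eq_divide)
    also have "\<dots> \<le> base TYPE('a) powr (real (ht j) * (- (real r - 1 / 4)))"
    proof (rule powr_mono)
      have "real ((4 * r - 1) * ht j) \<le> real (4 * decay j)" using decay_ge[of j] by linarith
      moreover have "real (4 * r - 1) = 4 * real r - 1" using r by (simp add: of_nat_diff)
      ultimately have "(4 * real r - 1) * real (ht j) \<le> 4 * real (decay j)" by simp
      thus "- real (decay j) \<le> real (ht j) * - (real r - 1 / 4)" by (simp add: algebra_simps)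
    qed (use base_gt_1 in simp)
    also have "\<dots> = height (approx j) powr - (real r - 1 / 4)"
      using base_gt_1 by (simp only: powr_powr[symmetric] height_approx powr_realpow)
    finally have "fls_absval (T.ev (approx j) alpha) \<le> height (approx j) powr - (real r - 1 / 4)" .
    moreover have "fls_absval (T.ev (approx j) alpha) > 0"
      using base_gt_1 by (simp add: ev_approx abv_val)
    ultimately show ?thesis using assms by (simp add: degree_approx)
  qed
  hence "finite (range approx)" using fin by (meson finite_subset image_subsetI)
  moreover have "inj approx"
  proof (rule injI)
    fix i j assume "approx i = approx j"
    hence "base TYPE('a) ^ ht i = base TYPE('a) ^ ht j" by (metis height_approx)
    hence "ht i = ht j" using base_gt_1 by (simp add: power_inject_exp)
    thus "i = j" using strict_mono_ht strict_mono_eq by blast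
  qed
  ultimately show False using finite_imageD infinite_UNIV_nat by blast
qed

end

context T_embedding
begin

section \<open>Resultants with a quadratic polynomial\<close>

text \<open>\<open>b\<close> and \<open>c\<close> are Vieta's relations. The scaled power sums s_k =
  a^k (x^k + y^k) satisfy Newton's recursion s_(l+2) = -b s_(l+1) - a c s_l, so they never leave the
  image of F_q[T].\<close>

lemma quadratic_trace_in_range:
  assumes b: "e b = - e a * (x + y)" and c: "e c = e a * x * y" and G: "degree G \<le> m"
  shows "e a ^ m * (ev G x + ev G y) \<in> range e"
proof -
  have R_add: "u + w \<in> range e" if "u \<in> range e" "w \<in> range e" for u w
    using that by (auto simp flip: e_add)
  have R_mult: "u * w \<in> range e" if "u \<in> range e" "w \<in> range e" for u w
    using that by (auto simp flip: e_mult)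
  have R_minus: "- u \<in> range e" if "u \<in> range e" for u
    using that by (auto simp flip: e_minus)
  have R_power: "u ^ k \<in> range e" if "u \<in> range e" for u k
    using that by (auto simp flip: e_power)
  have power_sum: "e a ^ k * (x ^ k + y ^ k) \<in> range e" for k
  proof (induction k rule: less_induct)
    case (less k)
    consider "k = 0" | "k = 1" | l where "k = Suc (Suc l)" by (metis One_nat_def not0_implies_Suc)
    thus ?case
    proof cases
      case 1
      have "1 + 1 \<in> range e" by (rule R_add) (metis e_1 rangeI)+
      thus ?thesis using 1 by simp
    next
      case 2
      have "- e b \<in> range e" by (intro R_minus) simp
      thus ?thesis using 2 b by simp
    next
      case 3
      have *: "e a ^ k * (x ^ k + y ^ k) = - e b * (e a ^ Suc l * (x ^ Suc l + y ^ Suc l))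
          + - (e a * e c) * (e a ^ l * (x ^ l + y ^ l))"
        unfolding 3 b c by (simp add: algebra_simps)
      have "e a ^ Suc l * (x ^ Suc l + y ^ Suc l) \<in> range e" by (rule less) (simp add: 3)
      then obtain s where s: "e a ^ Suc l * (x ^ Suc l + y ^ Suc l) = e s" unfolding image_iff by blast
      have "e a ^ l * (x ^ l + y ^ l) \<in> range e" by (rule less) (simp add: 3)
      then obtain t where t: "e a ^ l * (x ^ l + y ^ l) = e t" unfolding image_iff by blast
      have "- e b * e s + - (e a * e c) * e t = e (- b * s + - (a * c) * t)"
        by (simp only: e_add e_mult e_minus)
      thus ?thesis unfolding * s t by (simp only: rangeI)
    qed
  qed
  have "e a ^ m * (ev G x + ev G y)
      = (\<Sum>i\<le>degree G. e (coeff G i) * e a ^ (m - i) * (e a ^ i * (x ^ i + y ^ i)))"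
    unfolding ev_altdef sum.distrib[symmetric] sum_distrib_left
  proof (rule sum.cong)
    fix i assume "i \<in> {..degree G}"
    hence "e a ^ m = e a ^ (m - i) * e a ^ i" using G by (simp flip: power_add)
    show "e a ^ m * (e (coeff G i) * x ^ i + e (coeff G i) * y ^ i)
        = e (coeff G i) * e a ^ (m - i) * (e a ^ i * (x ^ i + y ^ i))"
      unfolding \<open>e a ^ m = _\<close> by (simp only: algebra_simps)
  qed simp
  also have "\<dots> \<in> range e"
  proof -
    have "(\<Sum>i\<in>I. e (coeff G i) * e a ^ (m - i) * (e a ^ i * (x ^ i + y ^ i))) \<in> range e"
      if "finite I" for I
      using that
    proof (induction I rule: finite_induct)
      case empty
      show ?case unfolding sum.empty by (rule range_eqI[of _ _ 0]) (simp only: e_0)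
    next
      case (insert i I)
      have "e (coeff G i) * e a ^ (m - i) * (e a ^ i * (x ^ i + y ^ i)) \<in> range e"
        by (rule R_mult[OF R_mult[OF rangeI R_power[OF rangeI]] power_sum])
      from R_add[OF this insert.IH] show ?case unfolding sum.insert[OF insert.hyps] .
    qed
    from this[OF finite_atMost] show ?thesis .
  qed
  finally show ?thesis .
qed

text \<open>Up to a power of a, this is the resultant with the quadratic. A Horner step reduces it
  to the trace: (d + x G(x)) (d + y G(y)) = d^2 + d (x G(x) + y G(y)) + x y G(x) G(y).\<close>

lemma quadratic_resultant_in_range:
  assumes b: "e b = - e a * (x + y)" and c: "e c = e a * x * y" and G: "degree G \<le> m"
  shows "e a ^ m * (ev G x * ev G y) \<in> range e"
  using G
proof (induction G arbitrary: m)
  case 0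
  show ?case by simp
next
  case (pCons d G)
  show ?case
  proof (cases "G = 0")
    case True
    have "e a ^ m * (ev (pCons d G) x * ev (pCons d G) y) = e (a ^ m * d * d)"
      by (simp add: ev_pCons True e_mult e_power)
    thus ?thesis by simp
  next
    case False
    then obtain k where k: "m = Suc k" "degree G \<le> k" using pCons.prems by (cases m) auto
    obtain s where s: "e s = e a ^ k * (ev G x * ev G y)" using pCons.IH[OF k(2)] by auto
    have "degree (pCons 0 G) \<le> m" using k False by simp
    from quadratic_trace_in_range[OF b c this]
    obtain t where t: "e t = e a ^ m * (ev (pCons 0 G) x + ev (pCons 0 G) y)" by auto
    have "e a ^ m * (ev (pCons d G) x * ev (pCons d G) y)
        = e a ^ m * e d * e d + e d * e t + e c * e s"
      unfolding t s c by (simp add: ev_pCons k algebra_simps)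
    also have "\<dots> = e (a ^ m * d * d + d * t + c * s)" by (simp add: e_add e_mult e_power)
    finally show ?thesis by simp
  qed
qed

end

section \<open>Finiteness of the set of polynomials of bounded degree and height\<close>

lemma finite_poly_coeffs_in:
  assumes S: "finite S"
  shows "finite {P :: 'c::zero poly. degree P \<le> k \<and> (\<forall>i. coeff P i \<in> S)}"
proof -
  have "{P :: 'c poly. degree P \<le> k \<and> (\<forall>i. coeff P i \<in> S)} \<subseteq> Poly ` {xs. set xs \<subseteq> S \<and> length xs \<le> Suc k}"
  proof
    fix P :: "'c poly" assume P: "P \<in> {P. degree P \<le> k \<and> (\<forall>i. coeff P i \<in> S)}"
    have "length (coeffs P) \<le> Suc k" using P by (cases "P = 0") (auto simp: length_coeffs_degree)
    moreover have "set (coeffs P) \<subseteq> S" using P by (auto simp: coeffs_def)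
    ultimately show "P \<in> Poly ` {xs. set xs \<subseteq> S \<and> length xs \<le> Suc k}"
      by (intro image_eqI[of _ _ "coeffs P"]) auto
  qed
  thus ?thesis using finite_lists_length_le[OF S] by (meson finite_imageI finite_subset)
qed

lemma finite_bounded_height:
  "finite {Q :: 'a::{finite,field} poly poly. degree Q \<le> n \<and> height Q \<le> X}"
proof -
  obtain k where k: "X < base TYPE('a) ^ k"
    using real_arch_pow card_field_gt_1[where 'a='a] by blast
  have "finite {c :: 'a poly. degree c \<le> k}" using finite_poly_coeffs_in[of "UNIV :: 'a set" k] by simp
  from finite_poly_coeffs_in[OF this, of n] have fin: "finite {Q :: 'a poly poly. degree Q \<le> n \<and> (\<forall>i. degree (coeff Q i) \<le> k)}"
    by simp
  have deg: "degree (coeff Q i) \<le> k" if "height Q \<le> X" for Q :: "'a poly poly" and i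
  proof (cases "coeff Q i = 0")
    case False
    have "base TYPE('a) ^ degree (coeff Q i) \<le> X"
      using height_ge[of Q i] that False by (simp add: Tpoly_absval_def)
    hence "base TYPE('a) ^ degree (coeff Q i) < base TYPE('a) ^ k" using k by simp
    hence "degree (coeff Q i) < k"
      using card_field_gt_1[where 'a='a] power_strict_increasing_iff by blast
    thus ?thesis by simp
  qed simp
  show ?thesis by (rule finite_subset[OF _ fin]) (use deg in blast)
qed

section \<open>The algebraic closure and its absolute value\<close>

locale closure_model =
  fixes iota :: "'a::{finite,field} fls \<Rightarrow> 'b::field" and v :: "'b \<Rightarrow> real"
  assumes model: "alg_closure_model iota v"
begin

lemmas model' = model[unfolded alg_closure_model_def]

lemma iota_add: "iota (x + y) = iota x + iota y" by (rule model'[THEN conjunct1, rule_format])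
lemma iota_mult: "iota (x * y) = iota x * iota y" by (rule model'[THEN conjunct2, THEN conjunct1, rule_format])
lemma iota_1: "iota 1 = 1" by (rule model'[THEN conjunct2, THEN conjunct2, THEN conjunct1])

lemmas model'' = model'[THEN conjunct2, THEN conjunct2, THEN conjunct2]

lemma alg_closed: "degree p \<ge> 1 \<Longrightarrow> \<exists>z. poly p z = (0 :: 'b)"
  by (rule model''[THEN conjunct1, rule_format])

lemmas absval = model''[THEN conjunct2, THEN conjunct2]

lemma v_nonneg [simp]: "v z \<ge> 0" by (rule absval[THEN conjunct1, rule_format])
lemma v_eq_0_iff [simp]: "v z = 0 \<longleftrightarrow> z = 0" by (rule absval[THEN conjunct2, THEN conjunct1, rule_format])
lemma v_0 [simp]: "v 0 = 0" by simp
lemma v_mult: "v (z * w) = v z * v w"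
  by (rule absval[THEN conjunct2, THEN conjunct2, THEN conjunct1, rule_format])
lemma v_triangle: "v (z + w) \<le> v z + v w"
  by (rule absval[THEN conjunct2, THEN conjunct2, THEN conjunct2, THEN conjunct1, rule_format])
lemma v_iota: "v (iota x) = fls_absval x"
  by (rule absval[THEN conjunct2, THEN conjunct2, THEN conjunct2, THEN conjunct2, rule_format])

lemma iota_0: "iota 0 = 0"
  using v_iota[of 0] by simp

lemma v_1 [simp]: "v 1 = 1"
  using v_iota[of 1] by (simp add: iota_1)

lemma v_power: "v (z ^ k) = v z ^ k"
  by (induction k) (simp_all add: v_mult)

lemma v_uminus [simp]: "v (- z) = v z"
proof -
  have "v (-1) * v (-1) = v ((-1) * (-1))" by (simp only: v_mult)
  hence "(v (-1))\<^sup>2 = 1" by (simp add: power2_eq_square)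
  hence "v (-1) = 1 \<or> v (-1) = -1" by (simp only: power2_eq_1_iff)
  hence "v (-1) = 1" using v_nonneg[of "-1"] by linarith
  thus ?thesis using v_mult[of "-1" z] by simp
qed

lemma v_diff: "v (z - w) \<le> v z + v w"
  using v_triangle[of z "- w"] by simp

lemma v_sum: "v (sum f I) \<le> (\<Sum>i\<in>I. v (f i))"
proof (induction I rule: infinite_finite_induct)
  case (insert i I)
  thus ?case using v_triangle[of "f i" "sum f I"] by simp
qed simp_all

definition eps :: "'a poly \<Rightarrow> 'b" where "eps = iota \<circ> T_poly_to_fls"

lemma eps_apply: "eps c = iota (T_poly_to_fls c)"
  by (simp add: eps_def)

sublocale E: T_embedding eps
proof unfold_locales
  fix a b :: "'a poly"
  show "eps (a + b) = eps a + eps b" unfolding eps_apply T.e_add by (rule iota_add)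
  show "eps (a * b) = eps a * eps b" unfolding eps_apply T.e_mult by (rule iota_mult)
  show "eps 1 = 1" unfolding eps_apply T.e_1 by (rule iota_1)
  assume "eps a = 0"
  hence "fls_absval (T_poly_to_fls a) = 0" unfolding eps_apply using v_iota[of "T_poly_to_fls a"] v_0 by metis
  thus "a = 0" by simp
qed

lemma v_eps: "v (eps a) = Tpoly_absval a"
  by (simp add: eps_apply v_iota abv_T_poly_to_fls)

lemma ev_iota: "E.ev Q (iota x) = iota (T.ev Q x)"
proof (induction Q)
  case (pCons a Q)
  show ?case by (simp only: E.ev_pCons T.ev_pCons pCons.IH iota_add iota_mult eps_apply[of a])
qed (simp add: iota_0)

text \<open>The model provides the ordinary triangle inequality for \<open>v\<close>, so estimates
  carry constants depending on the degree. The powers of 2 belong to the ball v x \<le> 2, which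
  contains alpha and all roots of the forms.\<close>

definition lipschitz_const :: "nat \<Rightarrow> real" where
  "lipschitz_const m = real (Suc m) * real (Suc m) * 2 ^ m"

lemma lipschitz_const_ge_1: "lipschitz_const m \<ge> 1"
proof -
  have "1 * 1 * 1 \<le> real (Suc m) * real (Suc m) * 2 ^ m" by (intro mult_mono) auto
  thus ?thesis by (simp add: lipschitz_const_def)
qed

lemma v_power_diff:
  assumes "v x \<le> 2" "v y \<le> 2"
  shows "v (x ^ i - y ^ i) \<le> real i * 2 ^ i * v (x - y)"
proof (induction i)
  case (Suc i)
  have "x ^ Suc i - y ^ Suc i = x * (x ^ i - y ^ i) + (x - y) * y ^ i" by (simp add: algebra_simps)
  hence "v (x ^ Suc i - y ^ Suc i) \<le> v x * v (x ^ i - y ^ i) + v (x - y) * v y ^ i"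
    by (metis v_triangle v_mult v_power)
  also have "\<dots> \<le> 2 * (real i * 2 ^ i * v (x - y)) + v (x - y) * 2 ^ i"
    using assms Suc by (intro add_mono mult_mono power_mono) auto
  also have "\<dots> \<le> real (Suc i) * 2 ^ Suc i * v (x - y)" by (simp add: algebra_simps)
  finally show ?case .
qed simp

lemma v_ev_diff:
  assumes "v x \<le> 2" "v y \<le> 2" and Q: "degree Q \<le> m"
  shows "v (E.ev Q x - E.ev Q y) \<le> lipschitz_const m * height Q * v (x - y)"
proof -
  have "E.ev Q x - E.ev Q y = (\<Sum>i\<le>degree Q. eps (coeff Q i) * (x ^ i - y ^ i))"
    unfolding E.ev_altdef sum_subtractf[symmetric] by (simp add: algebra_simps)
  also have "v \<dots> \<le> (\<Sum>i\<le>degree Q. v (eps (coeff Q i) * (x ^ i - y ^ i)))" by (rule v_sum)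
  also have "\<dots> \<le> (\<Sum>i\<le>degree Q. height Q * (real (Suc m) * 2 ^ m * v (x - y)))"
  proof (rule sum_mono)
    fix i assume "i \<in> {..degree Q}"
    hence i: "i \<le> m" using Q by simp
    have "v (x ^ i - y ^ i) \<le> real i * 2 ^ i * v (x - y)" by (rule v_power_diff) fact+
    also have "\<dots> \<le> real (Suc m) * 2 ^ m * v (x - y)"
      using i by (intro mult_mono power_increasing) auto
    finally show "v (eps (coeff Q i) * (x ^ i - y ^ i)) \<le> height Q * (real (Suc m) * 2 ^ m * v (x - y))"
      unfolding v_mult v_eps using height_ge[of Q i] order_trans[OF Tpoly_absval_nonneg height_ge[of Q i]]
      by (intro mult_mono) auto
  qed
  also have "\<dots> = real (Suc (degree Q)) * (height Q * (real (Suc m) * 2 ^ m * v (x - y)))" by simp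
  also have "\<dots> \<le> real (Suc m) * (height Q * (real (Suc m) * 2 ^ m * v (x - y)))"
    using Q order_trans[OF Tpoly_absval_nonneg height_ge[of Q 0]]
    by (intro mult_right_mono mult_nonneg_nonneg) auto
  finally show ?thesis by (simp add: lipschitz_const_def mult_ac)
qed

lemma v_ev_le:
  assumes "v x \<le> 2" and Q: "degree Q \<le> m"
  shows "v (E.ev Q x) \<le> lipschitz_const m * height Q"
proof -
  have h: "height Q \<ge> 0" using order_trans[OF Tpoly_absval_nonneg height_ge[of Q 0]] .
  have "v (E.ev Q x) \<le> (\<Sum>i\<le>degree Q. v (eps (coeff Q i) * x ^ i))"
    unfolding E.ev_altdef by (rule v_sum)
  also have "\<dots> \<le> (\<Sum>i\<le>degree Q. height Q * 2 ^ m)"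
  proof (rule sum_mono)
    fix i assume "i \<in> {..degree Q}"
    hence i: "i \<le> m" using Q by simp
    have "v x ^ i \<le> 2 ^ i" using assms by (intro power_mono) auto
    also have "\<dots> \<le> 2 ^ m" using i by (intro power_increasing) auto
    finally show "v (eps (coeff Q i) * x ^ i) \<le> height Q * 2 ^ m"
      unfolding v_mult v_eps v_power using height_ge[of Q i] h by (intro mult_mono) auto
  qed
  also have "\<dots> = real (Suc (degree Q)) * (height Q * 2 ^ m)" by simp
  also have "\<dots> \<le> (real (Suc m) * real (Suc m)) * (height Q * 2 ^ m)"
  proof (rule mult_right_mono)
    have "real (Suc (degree Q)) * 1 \<le> real (Suc m) * real (Suc m)"
      using Q by (intro mult_mono) auto
    thus "real (Suc (degree Q)) \<le> real (Suc m) * real (Suc m)" by simp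
  qed (use h in simp)
  finally show ?thesis by (simp add: lipschitz_const_def mult_ac)
qed

text \<open>One root comes from algebraic closedness and the other from Vieta, so a double root
  needs no separate treatment.\<close>

lemma quadratic_roots:
  assumes "a \<noteq> 0"
  obtains x y where "eps b = - eps a * (x + y)" "eps c = eps a * x * y"
    "\<And>z. E.ev [:c, b, a:] z = eps a * (z - x) * (z - y)"
proof -
  have a: "eps a \<noteq> 0" using assms E.e_0_iff by blast
  hence "degree [:eps c, eps b, eps a:] \<ge> 1" by simp
  then obtain x where "poly [:eps c, eps b, eps a:] x = 0" using alg_closed by blast
  hence x: "eps c = - (x * (eps b + x * eps a))" by (simp add: eq_neg_iff_add_eq_0)
  define y where "y = - eps b / eps a - x"
  have b: "eps b = - eps a * (x + y)" using a by (simp add: y_def)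
  have c: "eps c = eps a * x * y" unfolding x b by (simp add: algebra_simps)
  have "E.ev [:c, b, a:] z = eps a * (z - x) * (z - y)" for z
    unfolding E.ev_pCons b c by (simp add: algebra_simps)
  thus thesis using that b c by blast
qed

end

section \<open>Distance to algebraic numbers\<close>

text \<open>All conditions except the vanishing concern the polynomial alone, so a minimal
  polynomial can be carried to any of its roots, even in another field.\<close>

lemma is_minpoly_change_root:
  "is_minpoly e x Q \<Longrightarrow> poly (map_poly e' Q) x' = 0 \<Longrightarrow> is_minpoly e' x' Q"
  by (simp add: is_minpoly_def)

lemma height_smult_const:
  fixes Q :: "'a::{finite,field} poly poly"
  assumes "s \<noteq> 0"
  shows "height (smult [:s:] Q) = height Q"
proof -
  have "Tpoly_absval ([:s:] * c) = Tpoly_absval c" for c :: "'a poly"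
    using assms by (auto simp: Tpoly_absval_def)
  thus ?thesis using assms by (simp add: height_def)
qed

locale approximation_in_closure =
  quadratic_approximations r L A B D alpha + closure_model iota v
  for r L :: nat and A B D :: "'a::{finite,field} poly" and alpha :: "'a fls"
    and iota :: "'a fls \<Rightarrow> 'b::field" and v :: "'b \<Rightarrow> real"
begin

lemma v_alpha: "v (iota alpha) < 1"
  by (simp add: v_iota alpha_small)

lemma v_ev_approx_alpha: "v (E.ev (approx j) (iota alpha)) = 1 / base TYPE('a) ^ decay j"
  by (simp only: ev_iota v_iota ev_approx abv_val)

lemma v_ca: "v (eps (ca (Suc j))) = base TYPE('a) ^ ht j"
  by (simp only: v_eps Tpoly_absval_ca)

lemma v_cb_cc_le: "v (eps (cb (Suc j))) \<le> base TYPE('a) ^ ht j" "v (eps (cc (Suc j))) \<le> base TYPE('a) ^ ht j"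
  unfolding v_eps using degree_cb_cc[of j] by (auto intro!: Tpoly_absval_le)

lemma ev_approx_closure:
  "E.ev (approx j) z = eps (ca (Suc j)) * z\<^sup>2 + eps (cb (Suc j)) * z + eps (cc (Suc j))"
  unfolding approx_def E.ev_pCons by (simp add: power2_eq_square algebra_simps)

text \<open>The leading coefficient dominates, so a root satisfies (v z)^2 \<le> v z + 1.\<close>

lemma approx_root_bounded:
  assumes "E.ev (approx j) z = 0"
  shows "v z \<le> 2"
proof (rule ccontr)
  assume "\<not> ?thesis"
  hence z: "v z > 2" by simp
  let ?a = "base TYPE('a) ^ ht j"
  have a: "?a > 0" using base_gt_1 by simp
  have "eps (ca (Suc j)) * z\<^sup>2 = - (eps (cb (Suc j)) * z + eps (cc (Suc j)))"
    using assms unfolding ev_approx_closure by (simp only: eq_neg_iff_add_eq_0 add.assoc)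
  hence "v (eps (ca (Suc j)) * z\<^sup>2) = v (eps (cb (Suc j)) * z + eps (cc (Suc j)))"
    by (simp only: v_uminus)
  also have "\<dots> \<le> v (eps (cb (Suc j)) * z) + v (eps (cc (Suc j)))" by (rule v_triangle)
  also have "\<dots> \<le> ?a * v z + ?a"
    unfolding v_mult by (intro add_mono mult_right_mono v_cb_cc_le) simp
  finally have "?a * (v z)\<^sup>2 \<le> ?a * (v z + 1)"
    unfolding v_mult v_ca v_power by (simp add: algebra_simps)
  hence "(v z)\<^sup>2 \<le> v z + 1" using a by (simp only: mult_le_cancel_left_pos)
  moreover have "2 * v z \<le> (v z)\<^sup>2" using z by (simp add: power2_eq_square)
  ultimately show False using z by linarith
qed

text \<open>The resultant is a nonzero element of F_q[T] and has absolute value at least 1.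
  Expanding Q at both roots around alpha involves the distances mainly through their product, and
  that product is known exactly from P_j(alpha); neither distance is needed separately.\<close>

lemma resultant_inequality:
  assumes Q: "degree Q \<le> m" and nz: "\<And>z. E.ev (approx j) z = 0 \<Longrightarrow> E.ev Q z \<noteq> 0"
  defines "a \<equiv> base TYPE('a) ^ ht j" and "K \<equiv> lipschitz_const m"
    and "X \<equiv> fls_absval (T.ev Q alpha)" and "H \<equiv> height Q"
  shows "1 \<le> 7 * K * a ^ m * X * H + K\<^sup>2 * H\<^sup>2 * (a ^ m / (a * base TYPE('a) ^ decay j))"
proof -
  obtain x y where xy: "eps (cb (Suc j)) = - eps (ca (Suc j)) * (x + y)"
    "eps (cc (Suc j)) = eps (ca (Suc j)) * x * y"
    "\<And>z. E.ev [:cc (Suc j), cb (Suc j), ca (Suc j):] z = eps (ca (Suc j)) * (z - x) * (z - y)"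
    by (rule quadratic_roots[OF ca_nz]) blast
  have fact: "E.ev (approx j) z = eps (ca (Suc j)) * (z - x) * (z - y)" for z
    unfolding approx_def by (rule xy(3))
  have roots: "E.ev (approx j) x = 0" "E.ev (approx j) y = 0" unfolding fact by simp_all
  have a: "a > 0" using base_gt_1 by (simp add: a_def)
  have K: "K \<ge> 1" unfolding K_def by (rule lipschitz_const_ge_1)
  have H: "H \<ge> 0" unfolding H_def using order_trans[OF Tpoly_absval_nonneg height_ge[of Q 0]] .
  have al: "v (iota alpha) \<le> 2" using v_alpha by simp
  have X: "X = v (E.ev Q (iota alpha))" unfolding X_def by (simp only: ev_iota v_iota)
  have X0: "X \<ge> 0" "X \<le> K * H" unfolding X K_def H_def using v_ev_le[OF al Q] by simp_all
  define d1 d2 where "d1 = v (iota alpha - x)" and "d2 = v (iota alpha - y)"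
  have d0: "d1 \<ge> 0" "d2 \<ge> 0" by (simp_all add: d1_def d2_def)
  have d3: "d1 \<le> 3" "d2 \<le> 3"
    unfolding d1_def d2_def using v_diff[of "iota alpha" x] v_diff[of "iota alpha" y] v_alpha
      approx_root_bounded[OF roots(1)] approx_root_bounded[OF roots(2)] by linarith+
  have "a * d1 * d2 = 1 / base TYPE('a) ^ decay j"
    using v_ev_approx_alpha[of j] unfolding fact v_mult v_ca a_def d1_def d2_def .
  hence dd: "d1 * d2 = 1 / (a * base TYPE('a) ^ decay j)" using a by (simp add: field_simps)
  have Qz: "v (E.ev Q z) \<le> X + K * H * v (iota alpha - z)" if "v z \<le> 2" for z
  proof -
    have "v (E.ev Q z) = v (E.ev Q (iota alpha) - (E.ev Q (iota alpha) - E.ev Q z))"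
      by (simp only: diff_diff_eq2 add_diff_cancel_left')
    also have "\<dots> \<le> X + v (E.ev Q (iota alpha) - E.ev Q z)" unfolding X by (rule v_diff)
    also have "\<dots> \<le> X + K * H * v (iota alpha - z)"
      unfolding K_def H_def using v_ev_diff[OF al that Q] by simp
    finally show ?thesis .
  qed
  obtain s where s: "eps (ca (Suc j)) ^ m * (E.ev Q x * E.ev Q y) = eps s"
    using E.quadratic_resultant_in_range[OF xy(1,2) Q] unfolding image_iff by blast
  have "eps (ca (Suc j)) \<noteq> 0" using ca_nz E.e_0_iff by blast
  hence "eps s \<noteq> 0" unfolding s[symmetric] using nz roots by simp
  hence "s \<noteq> 0" using E.e_0 by metis
  hence "1 \<le> v (eps s)" unfolding v_eps by (rule Tpoly_absval_ge_1)
  also have "v (eps s) = a ^ m * (v (E.ev Q x) * v (E.ev Q y))"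
    unfolding s[symmetric] v_mult v_power v_ca a_def ..
  also have "\<dots> \<le> a ^ m * ((X + K * H * d1) * (X + K * H * d2))"
    unfolding d1_def d2_def using a X0 K H
    by (intro mult_left_mono mult_mono Qz[OF approx_root_bounded[OF roots(1)]]
        Qz[OF approx_root_bounded[OF roots(2)]]) auto
  also have "(X + K * H * d1) * (X + K * H * d2) = X * X + X * (K * H * (d1 + d2)) + K\<^sup>2 * H\<^sup>2 * (d1 * d2)"
    by (simp add: algebra_simps power2_eq_square)
  \<comment> \<open>One factor X is replaced by its trivial bound K H, and the two distances are at
    most 3 each; 1 + 6 gives the constant 7.\<close>
  also have "\<dots> \<le> X * (K * H) + X * (K * H * 6) + K\<^sup>2 * H\<^sup>2 * (d1 * d2)"
    using X0 K H d0 d3 by (intro add_mono mult_left_mono) auto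
  also have "a ^ m * \<dots> = 7 * K * a ^ m * X * H + K\<^sup>2 * H\<^sup>2 * (a ^ m / (a * base TYPE('a) ^ decay j))"
    unfolding dd by (simp add: algebra_simps)
  finally show ?thesis using a by (simp add: mult_left_mono)
qed

text \<open>Anisotropy excludes a linear factor, and primitivity leaves only a constant from F_q as
  cofactor.\<close>

lemma minpoly_of_approx_root:
  assumes Q: "is_minpoly eps z Q" and z: "E.ev (approx j) z = 0"
  shows "\<exists>s. s \<noteq> 0 \<and> approx j = smult [:s:] Q"
proof -
  obtain S where S: "approx j = Q * S" using E.minpoly_dvd[OF Q z] by (elim dvdE)
  have nz: "Q \<noteq> 0" "S \<noteq> 0" using S degree_approx[of j] by auto
  have "degree Q \<ge> 1" using Q by (simp add: is_minpoly_def)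
  moreover have sum: "degree Q + degree S = 2"
    using S nz degree_approx[of j] by (simp add: degree_mult_eq)
  moreover have "degree Q \<noteq> 1"
  proof
    assume 1: "degree Q = 1"
    hence S1: "degree S = 1" using sum by simp
    obtain u w where Qe: "Q = [:u, w:]" "w \<noteq> 0" using degree1_coeffs[OF 1] by metis
    obtain s t where Se: "S = [:s, t:]" using degree1_coeffs[OF S1] by metis
    have "[:cc (Suc j), cb (Suc j), ca (Suc j):] = [:u * s, u * t + w * s, w * t:]"
      using S unfolding approx_def Qe Se by (simp add: algebra_simps)
    hence c: "cc (Suc j) = u * s" "cb (Suc j) = u * t + w * s" "ca (Suc j) = w * t" by simp_all
    \<comment> \<open>A linear factor u + w X would make (u, -w) a nontrivial zero of the
      form.\<close>
    have "ca (Suc j) * u\<^sup>2 + cb (Suc j) * u * (- w) + cc (Suc j) * (- w)\<^sup>2 = 0"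
      unfolding c by (simp add: algebra_simps power2_eq_square)
    hence "- w = 0" using anisotropic_coefs[of "Suc j"] unfolding anisotropic_def by blast
    thus False using Qe by simp
  qed
  ultimately have "degree S = 0" by linarith
  then obtain s where s: "S = [:s:]" by (elim degree_eq_zeroE)
  have as: "approx j = smult s Q" unfolding S s by simp
  have "s dvd coeff (approx j) i" for i unfolding as by simp
  from this[of 0] this[of 1] this[of 2] have "is_unit s"
    using anisotropic_coefs[of "Suc j"] unfolding anisotropic_def
    by (simp add: coeff_approx)
  then obtain t where t: "s = [:t:]" "t dvd 1" by (auto elim: is_unit_polyE)
  moreover have "t \<noteq> 0" using nz s t by auto
  ultimately show ?thesis using as by blast
qed

lemma decay_ge_real: "(real r - 1 / 4) * real (ht j) \<le> real (decay j)"
proof -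
  have "real ((4 * r - 1) * ht j) \<le> real (4 * decay j)" using decay_ge[of j] by linarith
  moreover have "real (4 * r - 1) = 4 * real r - 1" using r by (simp add: of_nat_diff)
  ultimately have "(4 * real r - 1) * real (ht j) \<le> 4 * real (decay j)" by simp
  thus ?thesis by (simp add: algebra_simps)
qed

lemma power_quotient_bound:
  defines "q \<equiv> base TYPE('a)"
  shows "(q ^ ht j) ^ m / (q ^ ht j * q ^ decay j) \<le> q powr (- ((real r - real m + 3 / 4) * real (ht j)))"
proof -
  have q: "q > 1" unfolding q_def by (rule base_gt_1)
  have "(q ^ ht j) ^ m / (q ^ ht j * q ^ decay j)
      = q powr (real (ht j) * real m) / q powr (real (ht j) + real (decay j))"
    using q by (simp add: powr_realpow[symmetric] powr_add powr_powr[symmetric])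
  also have "\<dots> = q powr (real (ht j) * real m - real (ht j) - real (decay j))"
    by (simp add: powr_diff[symmetric] algebra_simps)
  also have "\<dots> \<le> q powr (- ((real r - real m + 3 / 4) * real (ht j)))"
    using q decay_ge_real[of j] by (intro powr_mono) (auto simp: algebra_simps)
  finally show ?thesis .
qed

text \<open>For Q(alpha) = 0 only the second term of the resultant inequality survives. In degree at
  most r it is bounded by a constant times H(P_j)^(-3/4), which tends to 0 and cannot stay above
  1.\<close>

lemma degree_minpoly_alpha:
  assumes Q: "is_minpoly T_poly_to_fls alpha Q"
  shows "degree Q \<ge> r + 1"
proof (rule ccontr)
  assume "\<not> ?thesis"
  hence deg: "degree Q \<le> r" by simp
  define q where "q = base TYPE('a)"
  have q: "q > 1" unfolding q_def by (rule base_gt_1)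
  define M where "M = (lipschitz_const r)\<^sup>2 * (height Q)\<^sup>2"
  have val0: "T.ev Q alpha = 0" using Q by (simp add: is_minpoly_def)
  have nz: "E.ev Q z \<noteq> 0" if z: "E.ev (approx j) z = 0" for j z
  proof
    assume "E.ev Q z = 0"
    from minpoly_of_approx_root[OF is_minpoly_change_root[OF Q this] z]
    obtain s where "approx j = smult [:s:] Q" by blast
    hence "T.ev (approx j) alpha = 0" by (simp only: T.ev_smult val0 mult_zero_right)
    thus False using abv_val[of j] base_gt_1 by (simp add: ev_approx)
  qed
  have M0: "M \<ge> 0" by (simp add: M_def)
  obtain i where i: "M < (q powr (3/4)) ^ i" using real_arch_pow[of "q powr (3/4)"] q by auto
  have "1 \<le> M * ((q ^ ht i) ^ r / (q ^ ht i * q ^ decay i))"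
    using resultant_inequality[OF deg nz, of i] unfolding val0 M_def q_def by simp
  also have "\<dots> \<le> M * q powr (- ((real r - real r + 3 / 4) * real (ht i)))"
    unfolding q_def by (intro mult_left_mono power_quotient_bound M0)
  also have "\<dots> \<le> M * q powr (- (3 / 4 * real i))"
    using ht_ge[of i] q M0 by (intro mult_left_mono powr_mono) auto
  also have "q powr (- (3 / 4 * real i)) = 1 / (q powr (3/4)) ^ i"
    using q by (simp add: powr_minus_divide powr_realpow[symmetric] powr_powr)
  finally have "(q powr (3/4)) ^ i \<le> M" using q by (simp add: field_simps)
  thus False using i by simp
qed

text \<open>With d = P'(alpha), d^2 = disc P + 4 a P(alpha) holds in every characteristic, including
  2, and both terms are at most the height.\<close>

lemma deriv_approx_le:
  "v ((eps (ca (Suc j)) + eps (ca (Suc j))) * iota alpha + eps (cb (Suc j))) \<le> base TYPE('a) powr (real (ht j) / 2)"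
proof -
  define q where "q = base TYPE('a)"
  have q: "q > 1" unfolding q_def by (rule base_gt_1)
  define d where "d = (\<tau> (ca (Suc j)) + \<tau> (ca (Suc j))) * alpha + \<tau> (cb (Suc j))"
  have iota_d: "(eps (ca (Suc j)) + eps (ca (Suc j))) * iota alpha + eps (cb (Suc j)) = iota d"
    by (simp only: d_def eps_apply[of "ca (Suc j)"] eps_apply[of "cb (Suc j)"] iota_add iota_mult)
  have "d\<^sup>2 = \<tau> ((cb (Suc j))\<^sup>2 - 4 * ca (Suc j) * cc (Suc j)) + \<tau> (4 * ca (Suc j)) * val (Suc j)"
  proof -
    have "\<tau> (1 + 1 + 1 + 1) = 1 + 1 + 1 + 1" by (simp only: T.e_add T.e_1)
    hence four: "\<tau> 4 = 4" by simp
    have "d\<^sup>2 = ((\<tau> (cb (Suc j)))\<^sup>2 - 4 * \<tau> (ca (Suc j)) * \<tau> (cc (Suc j))) + 4 * \<tau> (ca (Suc j)) * val (Suc j)"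
      unfolding d_def val_def by (simp add: algebra_simps power2_eq_square)
    thus ?thesis by (simp only: T.e_diff T.e_mult T.e_power four)
  qed
  also have "fls_absval \<dots> \<le> max (q ^ ht j) (q ^ ht j)"
  proof (rule order_trans[OF abv_add_le max.mono])
    show "fls_absval (\<tau> ((cb (Suc j))\<^sup>2 - 4 * ca (Suc j) * cc (Suc j))) \<le> q ^ ht j"
      unfolding abv_T_poly_to_fls q_def by (intro Tpoly_absval_le degree_disc_le)
    have "degree (4 * ca (Suc j)) \<le> ht j"
      using degree_mult_le[of 4 "ca (Suc j)"] by (simp add: ht_def)
    hence "fls_absval (\<tau> (4 * ca (Suc j))) \<le> q ^ ht j"
      unfolding abv_T_poly_to_fls q_def by (rule Tpoly_absval_le)
    moreover have "fls_absval (val (Suc j)) \<le> 1" using q by (simp add: abv_val q_def)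
    ultimately have "fls_absval (\<tau> (4 * ca (Suc j))) * fls_absval (val (Suc j)) \<le> q ^ ht j * 1"
      using q by (intro mult_mono) auto
    thus "fls_absval (\<tau> (4 * ca (Suc j)) * val (Suc j)) \<le> q ^ ht j" by (simp add: abv_mult)
  qed
  finally have "(fls_absval d)\<^sup>2 \<le> q powr real (ht j)" using q by (simp add: abv_power powr_realpow)
  also have "q powr real (ht j) = (q powr (real (ht j) / 2))\<^sup>2"
    by (simp add: power2_eq_square powr_add[symmetric])
  finally have "fls_absval d \<le> q powr (real (ht j) / 2)" by (rule power2_le_imp_le) simp
  thus ?thesis unfolding iota_d v_iota q_def .
qed

text \<open>Taylor expansion at alpha: the first derivative is the square root of the discriminant up to
  a negligible error, and this is what separates \<open>w_n^*\<close> from \<open>w_n\<close>.\<close>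

lemma approx_root_distance:
  assumes z: "E.ev (approx j) z = 0"
  defines "q \<equiv> base TYPE('a)"
  shows "1 / (2 * q ^ (2 * L)) * (q ^ ht j) powr (- (real r + 1 / 2)) \<le> v (iota alpha - z)"
proof (rule ccontr)
  assume neg: "\<not> ?thesis"
  define h where "h = real (ht j)"
  \<comment> \<open>The factor 2 accounts for the two terms of the Taylor expansion, and q^(2 L) for
    the additive constant in \<open>decay_le\<close>.\<close>
  define c where "c = 1 / (2 * q ^ (2 * L))"
  define d where "d = v (iota alpha - z)"
  have q: "q > 1" unfolding q_def by (rule base_gt_1)
  have "1 \<le> 2 * q ^ (2 * L)" using one_le_power[of q "2 * L"] q by linarith
  hence c: "c > 0" "c \<le> 1" using q by (simp_all add: c_def)
  have d0: "d \<ge> 0" by (simp add: d_def)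
  have d: "d < c * q powr (- ((real r + 1 / 2) * h))"
    using neg q unfolding d_def c_def h_def
    by (simp add: powr_realpow[symmetric] powr_powr algebra_simps)
  let ?D = "(eps (ca (Suc j)) + eps (ca (Suc j))) * iota alpha + eps (cb (Suc j))"
  have "E.ev (approx j) (iota alpha) = E.ev (approx j) (iota alpha) - E.ev (approx j) z" by (simp only: z diff_zero)
  also have "\<dots> = (iota alpha - z) * ?D - eps (ca (Suc j)) * (iota alpha - z)\<^sup>2"
    unfolding ev_approx_closure by (simp add: algebra_simps power2_eq_square)
  finally have "1 / q ^ decay j = v ((iota alpha - z) * ?D - eps (ca (Suc j)) * (iota alpha - z)\<^sup>2)"
    using v_ev_approx_alpha[of j] unfolding q_def by simp
  also have "\<dots> \<le> v ((iota alpha - z) * ?D) + v (eps (ca (Suc j)) * (iota alpha - z)\<^sup>2)" by (rule v_diff)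
  also have "\<dots> = d * v ?D + q ^ ht j * d\<^sup>2" unfolding v_mult v_power v_ca d_def q_def ..
  also have "\<dots> \<le> d * q powr (h / 2) + q powr h * d\<^sup>2"
    using deriv_approx_le[of j] d0 q unfolding q_def h_def
    by (intro add_mono mult_left_mono) (auto simp: powr_realpow)
  also have "\<dots> < c * q powr (- (real r * h)) + c * q powr (- (real r * h))"
  proof (rule add_less_le_mono)
    have "d * q powr (h / 2) < c * q powr (- ((real r + 1 / 2) * h)) * q powr (h / 2)"
      using d q by (intro mult_strict_right_mono) auto
    also have "\<dots> = c * q powr (- (real r * h))"
      by (simp add: powr_add[symmetric] algebra_simps)
    finally show "d * q powr (h / 2) < c * q powr (- (real r * h))" .
    have "q powr h * d\<^sup>2 \<le> q powr h * (c * q powr (- ((real r + 1 / 2) * h)))\<^sup>2"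
      using d d0 by (intro mult_left_mono power_mono) auto
    also have "\<dots> = c * (c * q powr (- (2 * real r * h)))"
      by (simp add: power2_eq_square powr_add[symmetric] algebra_simps)
    also have "\<dots> \<le> c * (1 * q powr (- (real r * h)))"
      using c q by (intro mult_left_mono mult_mono powr_mono) (auto simp: h_def)
    finally show "q powr h * d\<^sup>2 \<le> c * q powr (- (real r * h))" by simp
  qed
  also have "\<dots> = q powr (- (real r * h) - 2 * real L)"
    using q by (simp add: c_def powr_diff powr_realpow[symmetric])
  also have "\<dots> \<le> q powr (- real (decay j))"
  proof (rule powr_mono)
    have "real (decay j) \<le> real (r * ht j + 2 * L)" using decay_le[of j] of_nat_mono by blast
    thus "- (real r * h) - 2 * real L \<le> - real (decay j)" by (simp add: h_def)
  qed (use q in simp)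
  also have "\<dots> = 1 / q ^ decay j" using q by (simp add: powr_minus_divide powr_realpow)
  finally show False by simp
qed

end

section \<open>All algebraic numbers of degree at most n, and the exponents of alpha\<close>

context approximation_in_closure
begin

text \<open>The index j is the least one for which the second term of the resultant inequality is at
  most 1/2. Minimality bounds H(P_j) by a power of H(Q). Then either Q is proportional to P_j and
  the distance to its roots is known, or the first term is at least 1/2. \<open>room\<close> says
  precisely that the resulting exponent 2 r n / sigma + 2 is at most r + 1/2.\<close>

lemma distance_lower_bound:
  fixes n :: nat
  defines "\<sigma> \<equiv> real r - real n + 3 / 4"
  assumes \<sigma>: "\<sigma> > 0" and room: "2 * real r * real n \<le> (real r - 3 / 2) * \<sigma>"
  shows "\<exists>c>0. \<forall>z Q. is_minpoly eps z Q \<longrightarrow> degree Q \<le> n \<longrightarrow>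
           c * height Q powr (- (real r + 1 / 2)) \<le> v (iota alpha - z)"
proof -
  define q where "q = base TYPE('a)"
  have q: "q > 1" unfolding q_def by (rule base_gt_1)
  define K where "K = lipschitz_const n"
  have K: "K \<ge> 1" unfolding K_def by (rule lipschitz_const_ge_1)
  hence K2: "1 \<le> 2 * K\<^sup>2" using one_le_power[OF K, of 2] by linarith
  \<comment> \<open>The factor q^(ht 0) covers both possibilities for the least index: j = 0
    directly, and j > 0 because it absorbs the summand 2 L of the height recursion.\<close>
  define C where "C = q ^ ht 0 * (2 * K\<^sup>2) powr (real r / \<sigma>)"
  have C: "C > 0" unfolding C_def by (intro mult_pos_pos zero_less_power) (use q K in auto)
  \<comment> \<open>One bound per case: z outside the ball, the resultant case with 14 = 2 * 7, and
    roots of a form.\<close>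
  define c where "c = min 1 (min (1 / (14 * K\<^sup>2 * C ^ n)) (1 / (2 * q ^ (2 * L))))"
  have c: "c > 0" "c \<le> 1" "c \<le> 1 / (14 * K\<^sup>2 * C ^ n)" "c \<le> 1 / (2 * q ^ (2 * L))"
    unfolding c_def using C K q by auto
  have "c * height Q powr (- (real r + 1 / 2)) \<le> v (iota alpha - z)"
    if Q: "is_minpoly eps z Q" "degree Q \<le> n" for z Q
  proof -
    define H where "H = height Q"
    have "Q \<noteq> 0" using Q by (auto simp: is_minpoly_def)
    hence H: "H \<ge> 1" unfolding H_def by (rule height_ge_1)
    have Hp: "H powr (- (real r + 1 / 2)) = 1 / H powr (real r + 1 / 2)" 
      by (rule powr_minus_divide)
    have Hp1: "H powr x \<ge> 1" if "x \<ge> 0" for x using H that by (rule ge_one_powr_ge_zero)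
    have "c * H powr (- (real r + 1 / 2)) \<le> v (iota alpha - z)"
    proof (cases "v z \<le> 2")
      case False
      have "v z \<le> v (iota alpha - z) + v (iota alpha)"
        using v_diff[of "iota alpha" "iota alpha - z"] by simp
      hence "1 \<le> v (iota alpha - z)" using v_alpha False by linarith
      moreover have "c * H powr (- (real r + 1 / 2)) \<le> 1 * 1"
        unfolding Hp using c Hp1[of "real r + 1 / 2"]
        by (intro mult_mono) (simp_all add: divide_le_eq_1)
      ultimately show ?thesis by linarith
    next
      case True
      define \<theta> where "\<theta> = v (iota alpha - z)"
      have \<theta>: "\<theta> \<ge> 0" by (simp add: \<theta>_def)
      define large where "large j \<longleftrightarrow> 2 * K\<^sup>2 * H\<^sup>2 \<le> q powr (\<sigma> * real (ht j))" for j
      have ex: "\<exists>j. large j"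
      proof -
        obtain j where "2 * K\<^sup>2 * H\<^sup>2 < (q powr \<sigma>) ^ j"
          using real_arch_pow[of "q powr \<sigma>"] q \<sigma> by auto
        also have "(q powr \<sigma>) ^ j = q powr (\<sigma> * real j)"
          using q by (simp add: powr_realpow[symmetric] powr_powr)
        also have "\<dots> \<le> q powr (\<sigma> * real (ht j))"
          using q \<sigma> ht_ge[of j] by (intro powr_mono mult_left_mono) auto
        finally show ?thesis unfolding large_def by (intro exI[of _ j]) simp
      qed
      define j where "j = (LEAST j. large j)"
      have lj: "large j" unfolding j_def using ex by (rule LeastI_ex)
      define a where "a = q ^ ht j"
      have a0: "a > 0" unfolding a_def using q by simp
      have a: "a \<le> C * H powr (2 * real r / \<sigma>)"
      proof (cases j)
        case 0
        have "1 \<le> (2 * K\<^sup>2) powr (real r / \<sigma>)" using K2 \<sigma> by (intro ge_one_powr_ge_zero) auto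
        moreover have "1 \<le> H powr (2 * real r / \<sigma>)" using \<sigma> by (intro Hp1) auto
        ultimately have "q ^ ht 0 * (1 * 1) \<le> q ^ ht 0 * ((2 * K\<^sup>2) powr (real r / \<sigma>) * H powr (2 * real r / \<sigma>))"
          using q by (intro mult_left_mono mult_mono) auto
        thus ?thesis unfolding a_def C_def 0 by (simp add: mult.assoc)
      next
        case (Suc i)
        have "\<not> large i" using not_less_Least[of i large] Suc unfolding j_def by simp
        hence less: "q powr (\<sigma> * real (ht i)) < 2 * K\<^sup>2 * H\<^sup>2" unfolding large_def by simp
        have "q ^ (r * ht i) = (q powr (\<sigma> * real (ht i))) powr (real r / \<sigma>)"
          using q \<sigma> by (simp add: powr_powr powr_realpow[symmetric] mult.commute)
        also have "\<dots> \<le> (2 * K\<^sup>2 * H\<^sup>2) powr (real r / \<sigma>)"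
          using less \<sigma> by (intro powr_mono2) auto
        also have "\<dots> = (2 * K\<^sup>2) powr (real r / \<sigma>) * (H powr 2) powr (real r / \<sigma>)"
          using H K2 by (simp add: powr_mult)
        also have "(H powr 2) powr (real r / \<sigma>) = H powr (2 * real r / \<sigma>)" by (simp add: powr_powr)
        finally have "q ^ (2 * L) * q ^ (r * ht i)
            \<le> q ^ ht 0 * ((2 * K\<^sup>2) powr (real r / \<sigma>) * H powr (2 * real r / \<sigma>))"
          using q r by (intro mult_mono power_increasing) (auto simp: ht_0)
        thus ?thesis unfolding a_def C_def Suc ht_Suc power_add by (simp add: mult_ac)
      qed
      show ?thesis
      proof (cases "\<exists>y. E.ev (approx j) y = 0 \<and> E.ev Q y = 0")
        case True
        then obtain y where y: "E.ev (approx j) y = 0" "E.ev Q y = 0" by blast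
        from minpoly_of_approx_root[OF is_minpoly_change_root[OF Q(1) y(2)] y(1)]
        obtain s where s: "s \<noteq> 0" "approx j = smult [:s:] Q" by blast
        have "E.ev Q z = 0" using Q by (simp add: is_minpoly_def)
        hence "E.ev (approx j) z = 0" unfolding s(2) E.ev_smult by (simp only: mult_zero_right)
        from approx_root_distance[OF this]
        have "1 / (2 * q ^ (2 * L)) * a powr (- (real r + 1 / 2)) \<le> \<theta>"
          unfolding a_def \<theta>_def q_def .
        moreover have "a = H"
          using height_approx[of j] unfolding s(2) height_smult_const[OF s(1)] a_def H_def q_def by simp
        moreover have "c * H powr (- (real r + 1 / 2)) \<le> 1 / (2 * q ^ (2 * L)) * H powr (- (real r + 1 / 2))"
          using c by (intro mult_right_mono) auto
        ultimately show ?thesis unfolding \<theta>_def by (metis order_trans)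
      next
        case False
        define X where "X = fls_absval (T.ev Q alpha)"
        have ineq: "1 \<le> 7 * K * a ^ n * X * H + K\<^sup>2 * H\<^sup>2 * (a ^ n / (a * q ^ decay j))"
          using resultant_inequality[OF Q(2), of j] False unfolding K_def a_def X_def H_def q_def by blast
        have "K\<^sup>2 * H\<^sup>2 * (a ^ n / (a * q ^ decay j)) \<le> K\<^sup>2 * H\<^sup>2 * q powr (- (\<sigma> * real (ht j)))"
          using power_quotient_bound[of j n] unfolding a_def q_def \<sigma>_def by (intro mult_left_mono) auto
        also have "\<dots> \<le> 1 / 2"
          using lj q unfolding large_def by (simp add: powr_minus_divide field_simps)
        finally have "1 / 2 \<le> 7 * K * a ^ n * X * H" using ineq by linarith
        also have "X \<le> K * H * \<theta>"
        proof -
          have "E.ev Q z = 0" using Q by (simp add: is_minpoly_def)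
          hence "X = v (E.ev Q (iota alpha) - E.ev Q z)" unfolding X_def by (simp only: ev_iota v_iota diff_zero)
          also have "\<dots> \<le> K * H * \<theta>"
            unfolding K_def H_def \<theta>_def using v_alpha Q \<open>v z \<le> 2\<close> by (intro v_ev_diff) auto
          finally show ?thesis .
        qed
        hence "7 * K * a ^ n * X * H \<le> 7 * K * a ^ n * (K * H * \<theta>) * H"
          using K a0 H by (intro mult_right_mono mult_left_mono) auto
        also have "\<dots> = 7 * K\<^sup>2 * (a ^ n * H\<^sup>2) * \<theta>" by (simp add: power2_eq_square)
        also have "\<dots> \<le> 7 * K\<^sup>2 * (C ^ n * H powr (real r + 1 / 2)) * \<theta>"
        proof (intro mult_right_mono mult_left_mono \<theta>)
          have "a ^ n \<le> (C * H powr (2 * real r / \<sigma>)) ^ n" using a a0 by (intro power_mono) auto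
          also have "\<dots> = C ^ n * H powr (2 * real r / \<sigma> * real n)"
            using H by (simp add: power_mult_distrib powr_realpow[symmetric] powr_powr)
          finally have "a ^ n * H\<^sup>2 \<le> C ^ n * H powr (2 * real r / \<sigma> * real n) * H powr 2"
            using H by (simp add: mult_right_mono)
          also have "\<dots> = C ^ n * H powr (2 * real r / \<sigma> * real n + 2)"
            by (simp only: powr_add mult.assoc)
          also have "\<dots> \<le> C ^ n * H powr (real r + 1 / 2)"
          proof (intro mult_left_mono powr_mono H)
            have "2 * real r * real n / \<sigma> \<le> real r - 3 / 2"
              using room \<sigma> by (simp add: pos_divide_le_eq)
            thus "2 * real r / \<sigma> * real n + 2 \<le> real r + 1 / 2" by simp
          qed (use C in simp)
          finally show "a ^ n * H\<^sup>2 \<le> C ^ n * H powr (real r + 1 / 2)" .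
        qed (use K in simp)
        finally have "1 / 2 \<le> 7 * K\<^sup>2 * (C ^ n * H powr (real r + 1 / 2)) * \<theta>" .
        hence "1 / (14 * K\<^sup>2 * C ^ n) * H powr (- (real r + 1 / 2)) \<le> \<theta>"
          unfolding Hp using C K H by (simp add: field_simps)
        moreover have "c * H powr (- (real r + 1 / 2)) \<le> 1 / (14 * K\<^sup>2 * C ^ n) * H powr (- (real r + 1 / 2))"
          using c by (intro mult_right_mono) auto
        ultimately show ?thesis unfolding \<theta>_def by linarith
      qed
    qed
    thus ?thesis unfolding H_def .
  qed
  thus ?thesis using c(1) by blast
qed

text \<open>A larger w would bound the heights of all admissible numbers, and finitely many
  polynomials have finitely many roots. The 1 between r + 1/2 and r - 1/2 is the one in the
  definition of w^*.\<close>

lemma wstar_exp_le: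
  fixes n :: nat
  defines "\<sigma> \<equiv> real r - real n + 3 / 4"
  assumes \<sigma>: "\<sigma> > 0" and room: "2 * real r * real n \<le> (real r - 3 / 2) * \<sigma>"
  shows "wstar_exp iota v n alpha \<le> ereal (real r - 1 / 2)"
proof -
  obtain c where c: "c > 0" and lower: "\<And>z Q. is_minpoly eps z Q \<Longrightarrow> degree Q \<le> n \<Longrightarrow>
      c * height Q powr (- (real r + 1 / 2)) \<le> v (iota alpha - z)"
    using distance_lower_bound[of n] \<sigma> room unfolding \<sigma>_def by blast
  have "w \<le> real r - 1 / 2"
    if inf: "infinite {z. is_algebraic_over_FqT eps z \<and> alg_deg eps z \<le> n \<and>
      0 < v (iota alpha - z) \<and> v (iota alpha - z) \<le> alg_height eps z powr (- w - 1)}" (is "infinite ?S") for w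
  proof (rule ccontr)
    assume neg: "\<not> ?thesis"
    define d where "d = w - (real r - 1 / 2)"
    have d: "d > 0" using neg by (simp add: d_def)
    define F where "F = {Q :: 'a poly poly. degree Q \<le> n \<and> height Q \<le> (1 / c) powr (1 / d)}"
    have "finite F" unfolding F_def by (rule finite_bounded_height)
    hence "finite (\<Union>Q\<in>F - {0}. {z. E.ev Q z = 0})"
      by (intro finite_UN_I) (auto intro!: poly_roots_finite simp: E.map_poly_e_0_iff)
    moreover have "?S \<subseteq> (\<Union>Q\<in>F - {0}. {z. E.ev Q z = 0})"
    proof
      fix z assume z: "z \<in> ?S"
      then obtain Q where Q: "is_minpoly eps z Q" by (auto simp: is_algebraic_over_FqT_def)
      have mp: "minpoly eps z = Q" using Q by (rule E.minpoly_eqI)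
      have deg: "degree Q \<le> n" and up: "v (iota alpha - z) \<le> height Q powr (- w - 1)"
        using z by (auto simp: alg_deg_def alg_height_def mp)
      have Q0: "Q \<noteq> 0" using Q by (auto simp: is_minpoly_def)
      hence H: "height Q \<ge> 1" by (rule height_ge_1)
      have "c * height Q powr (- (real r + 1 / 2)) \<le> height Q powr (- w - 1)"
        using lower[OF Q deg] up by linarith
      also have "height Q powr (- w - 1) = height Q powr (- (real r + 1 / 2)) * height Q powr (- d)"
        unfolding powr_add[symmetric] by (rule arg_cong) (simp add: d_def algebra_simps)
      finally have "height Q powr (- (real r + 1 / 2)) * c
          \<le> height Q powr (- (real r + 1 / 2)) * height Q powr (- d)" by (subst mult.commute)
      moreover have "height Q powr (- (real r + 1 / 2)) > 0" using H by simp
      ultimately have "c \<le> height Q powr (- d)" by (simp only: mult_le_cancel_left_pos)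
      hence "height Q powr d \<le> 1 / c" using c H by (simp add: powr_minus_divide field_simps)
      hence "(height Q powr d) powr (1 / d) \<le> (1 / c) powr (1 / d)"
        using d by (intro powr_mono2) auto
      hence "height Q \<le> (1 / c) powr (1 / d)" using d H by (simp add: powr_powr)
      moreover have "E.ev Q z = 0" using Q by (simp add: is_minpoly_def)
      ultimately show "z \<in> (\<Union>Q\<in>F - {0}. {z. E.ev Q z = 0})"
        using deg Q0 unfolding F_def by blast
    qed
    ultimately show False using inf finite_subset by blast
  qed
  thus ?thesis unfolding wstar_exp_def eps_def[symmetric] by (intro Sup_least) auto
qed

text \<open>Clearing denominators in the fixed point equation gives -B X^(r+1) - D X^r + A X + B, so
  the degree is at most r + 1. That it is no smaller comes from the resultant argument, without an
  irreducibility proof for this polynomial.\<close>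

lemma alpha_algebraic: "is_algebraic_over_FqT T_poly_to_fls alpha"
  and alg_deg_alpha: "alg_deg T_poly_to_fls alpha = r + 1"
proof -
  define F where "F = monom (- B) (r + 1) + monom (- D) r + monom A 1 + monom B 0"
  have ev_monom: "T.ev (monom a k) x = \<tau> a * x ^ k" for a k x
    by (simp add: map_poly_monom poly_monom)
  have "coeff F (r + 1) = - B" using r by (simp add: F_def)
  hence F0: "F \<noteq> 0" using B_nz by auto
  have evF: "T.ev F alpha = 0"
    using alpha_eq unfolding F_def T.ev_add ev_monom by (simp add: T.e_minus algebra_simps)
  have degF: "degree F \<le> r + 1"
    unfolding F_def by (intro degree_add_le order.trans[OF degree_monom_le]) auto
  obtain Q where Q: "is_minpoly T_poly_to_fls alpha Q" using T.minpoly_exists[OF F0 evF] by blast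
  thus "is_algebraic_over_FqT T_poly_to_fls alpha" unfolding is_algebraic_over_FqT_def by blast
  have "degree Q \<le> r + 1" using T.minimal_degree_of_minpoly[OF Q F0 evF] degF by linarith
  moreover have "degree Q \<ge> r + 1" by (rule degree_minpoly_alpha[OF Q])
  ultimately show "alg_deg T_poly_to_fls alpha = r + 1"
    unfolding alg_deg_def T.minpoly_eqI[OF Q] by simp
qed

end

text \<open>Translation by 1 permutes the field, so summing over all elements gives |F| * 1 = 0.
  This identifies the characteristic as p and makes x^r additive.\<close>

lemma of_nat_card_UNIV: "of_nat (card (UNIV :: 'a::{finite,ring_1} set)) = (0 :: 'a)"
proof -
  have "(\<Sum>x\<in>UNIV. x + 1 :: 'a) = (\<Sum>x\<in>UNIV. x)"
    by (rule sum.reindex_bij_witness[of _ "\<lambda>x. x - 1" "\<lambda>x. x + 1"]) auto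
  thus ?thesis by (simp add: sum.distrib)
qed

theorem theorem1p2:
  fixes p s t n q r :: nat
    and iota :: "'a::{finite,field} fls \<Rightarrow> 'b::field" and v :: "'b \<Rightarrow> real"
  assumes "prime p" and "n \<ge> 2" and "s \<ge> 1" and "t \<ge> 1"
    and "card (UNIV :: 'a set) = q" and "q = p ^ s" and "r = q ^ t"
    and "real r \<ge> (3 * real n + 2 + sqrt (9 * (real n)\<^sup>2 + 4 * real n + 4)) / 2"
    and "q \<ge> 4"
    and "alg_closure_model iota v"
  shows "\<exists>alpha :: 'a fls. is_algebraic_over_FqT T_poly_to_fls alpha
           \<and> alg_deg T_poly_to_fls alpha = r + 1
           \<and> w_exp n alpha \<noteq> wstar_exp iota v n alpha"
proof -
  have "CHAR('a) dvd p ^ s"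
    using of_nat_card_UNIV[where 'a='a] assms(5,6) by (simp only: of_nat_eq_0_iff_char_dvd)
  moreover have "prime CHAR('a)"
    using prime_CHAR_semidom[where 'a='a] finite_imp_CHAR_pos[where 'a='a] by simp
  ultimately have char: "CHAR('a) = p" "prime CHAR('a)"
    using assms(1) prime_dvd_power primes_dvd_imp_eq by blast+
  have r_power: "r = CHAR('a) ^ (s * t)" using assms(6,7) char by (simp add: power_mult)
  have frob_poly: "(x + y) ^ r = x ^ r + y ^ r" for x y :: "'a poly"
    using char(2) r_power by (intro freshmans_dream') auto
  have frob_fls: "(x + y) ^ r = x ^ r + y ^ r" for x y :: "'a fls"
    using char(2) r_power by (intro freshmans_dream') auto
  define N R where "N = real n" and "R = real r"
  have N: "N \<ge> 2" using assms(2) by (simp add: N_def)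
  define S where "S = sqrt (9 * N\<^sup>2 + 4 * N + 4)"
  have S: "S \<ge> 0" "S\<^sup>2 = 9 * N\<^sup>2 + 4 * N + 4" using N by (simp_all add: S_def)
  have R: "2 * R \<ge> 3 * N + 2 + S" using assms(8) unfolding N_def R_def S_def by simp
  hence "S\<^sup>2 \<le> (2 * R - (3 * N + 2))\<^sup>2" using S by (intro power_mono) auto
  \<comment> \<open>The bound assumed for r is the larger root of this quadratic, whose discriminant
    is (3 N + 2)^2 - 8 N = 9 N^2 + 4 N + 4.\<close>
  hence quad: "R\<^sup>2 - (3 * N + 2) * R + 2 * N \<ge> 0" unfolding S(2) by (simp add: algebra_simps power2_eq_square)
  have "3 * N \<le> S" by (rule power2_le_imp_le) (use S N in \<open>simp_all add: power_mult_distrib\<close>)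
  hence R3: "R \<ge> 3 * N + 1" using R by linarith
  have r: "r \<ge> 2" using R3 N by (simp add: R_def)
  define l where "l = 2 * r\<^sup>2 - 1"
  have "1 * 1 \<le> r * r" using r by (intro mult_le_mono) auto
  hence l: "Suc l = 2 * r\<^sup>2" unfolding l_def power2_eq_square by linarith
  then obtain k where k: "l = Suc k" by (cases l) (auto simp: power2_eq_square)
  \<comment> \<open>N = W^L has the entries F_(L-1), F_L, F_(L+1) with L = \<open>Suc l\<close>; its
    inverse changes the sign of the off-diagonal entry, hence the minus in \<open>B\<close>. The
    determinant is (-1)^L = 1 because L is even.\<close>
  define A B D :: "'a poly" where "A = fib_poly (Suc (Suc l))" and "B = - fib_poly (Suc l)" and "D = fib_poly l"
  have det: "A * D - B\<^sup>2 = 1"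
    using fib_poly_cassini[of l, where 'a='a] unfolding l A_def B_def D_def power2_minus by simp
  have D_eq: "D = A + [:0, 1:] * B" unfolding A_def B_def D_def by simp
  have deg: "degree A = 2 * r\<^sup>2" "degree B = 2 * r\<^sup>2 - 1" "degree D = 2 * r\<^sup>2 - 2"
    unfolding A_def B_def D_def l[symmetric] degree_minus k degree_fib_poly by simp_all
  obtain alpha :: "'a fls" where alpha: "fls_absval alpha < 1"
    "alpha * (T_poly_to_fls A - T_poly_to_fls B * alpha ^ r) = T_poly_to_fls D * alpha ^ r - T_poly_to_fls B"
    using exists_fixed_laurent[OF det _ _ _ frob_fls] deg r by auto
  interpret approximation_in_closure r "2 * r\<^sup>2" A B D alpha iota v
    by unfold_locales (use r frob_poly frob_fls D_eq det deg alpha assms(10) in auto)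
  have "R - N + 3 / 4 > 0" using R3 N by linarith
  moreover have "2 * R * N \<le> (R - 3 / 2) * (R - N + 3 / 4)"
  proof -
    \<comment> \<open>The required inequality is the quadratic one plus a linear remainder, which is
      nonnegative because R is at least 3 N + 1.\<close>
    have "(R - 3 / 2) * (R - N + 3 / 4) - 2 * R * N
      = (R\<^sup>2 - (3 * N + 2) * R + 2 * N) + (5 / 4 * R - N / 2 - 9 / 8)"
      by (simp add: algebra_simps power2_eq_square)
    moreover have "5 / 4 * R - N / 2 - 9 / 8 \<ge> 0" using R3 N by linarith
    ultimately show ?thesis using quad by linarith
  qed
  ultimately have "wstar_exp iota v n alpha \<le> ereal (real r - 1 / 2)"
    unfolding R_def N_def by (intro wstar_exp_le) auto
  also have "\<dots> < ereal (real r - 1 / 4)" by simp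
  also have "\<dots> \<le> w_exp n alpha" by (rule w_exp_ge[OF assms(2)])
  finally have "w_exp n alpha \<noteq> wstar_exp iota v n alpha" by simp
  thus ?thesis using alpha_algebraic alg_deg_alpha by blast
qed

end
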